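(* For every graded vector bundle $\mathcal E$ over a graded manifold $\mathcal M$, its sheaf of sections $\Gamma_{\mathcal E}$ is geometric.
   Context: Graded means $\mathbb{Z}$-graded. Graded vector spaces and modules are sequences indexed by $j\in\mathbb Z$; all elements are homogeneous and $|v|$ is the degree. Graded manifold $\mathcal M$: a second countable Hausdorff space $M$ with a sheaf $\mathcal{C}^\infty_{\mathcal M}$ of graded commutative associative unital real algebras, locally isomorphic to the following model: an open subset of $\mathbb R^{n_0}$ with the sheaf of formal power series in graded commuting variables of nonzero degrees ($n_j$ of degree $j\neq 0$), with smooth coefficients; $\sum_j n_j$ is finite. Each function $f$ has a body $\underline f$ (a smooth function, zero if $|f|\neq0$), and $f(m):=\underline f(m)$. Graded vector bundle $\mathcal E$: a sheaf $\Gamma_{\mathcal E}$ of graded $\mathcal{C}^\infty_{\mathcal M}$-modules locally isomorphic to $\mathcal{C}^\infty_{\mathcal M}\otimes_{\mathbb R}K$ for a fixed finite-dimensional graded vector space $K$. For open $U\subseteq M$ and $a\in U$ let $\mathcal J^a_{\mathcal M}(U)=\{f\in\mathcal{C}^\infty_{\mathcal M}(U): f(a)=0\}$. For a graded $\mathcal{C}^\infty_{\mathcal M}(U)$-module $P$ let $P^{[q,a]}$ be the graded submodule generated by all $f\cdot p$ with $f\in(\mathcal J^a_{\mathcal M}(U))^q$, $p\in P$, and $P^\bullet=\bigcap_{q\in\mathbb N}\bigcap_{a\in U}P^{[q,a]}$. $P$ is geometric if $P^\bullet=0$. A presheaf $\mathcal F$ of graded $\mathcal C^\infty_{\mathcal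 M}$-modules is geometric if $\mathcal F(U)$ is a geometric graded $\mathcal C^\infty_{\mathcal M}(U)$-module for every open $U\subseteq M$. *)

theory Defs
  imports
    "HOL-Analysis.Analysis"
    "HOL-Algebra.Module"
    "HOL-Library.Multiset"
begin

section \<open>Graded vector spaces, algebras and modules\<close>

text \<open>
  A graded real vector space is a family \<open>V :: int \<Rightarrow> (real, 'a) module\<close> of vector spaces, one for
  each degree. The ring record underlying \<open>(real, 'a) module\<close> also has fields \<open>mult\<close> and \<open>one\<close>;
  they play no role here. All operations are indexed by the degrees of their arguments; a product
  \<open>m i j f g\<close> of \<open>f\<close> of degree \<open>i\<close> and \<open>g\<close> of degree \<open>j\<close> has degree \<open>i + j\<close>.
\<close>

definition real_ring :: "real ring"
  where "real_ring =
    \<lparr>carrier = UNIV, mult = (*), one = 1, zero = 0, add = (+)\<rparr>"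

definition linear_map :: "(real, 'a) module \<Rightarrow> (real, 'b) module \<Rightarrow> ('a \<Rightarrow> 'b) \<Rightarrow> bool"
  where "linear_map V W h \<longleftrightarrow>
    h \<in> carrier V \<rightarrow> carrier W \<and>
    (\<forall>x\<in>carrier V. \<forall>y\<in>carrier V. h (x \<oplus>\<^bsub>V\<^esub> y) = h x \<oplus>\<^bsub>W\<^esub> h y) \<and>
    (\<forall>r. \<forall>x\<in>carrier V. h (r \<odot>\<^bsub>V\<^esub> x) = r \<odot>\<^bsub>W\<^esub> h x)"

definition finite_dim_graded :: "(int \<Rightarrow> (real, 'k) module) \<Rightarrow> bool"
  where "finite_dim_graded K \<longleftrightarrow>
    (\<forall>j. Module.module real_ring (K j)) \<and>
    finite {j. carrier (K j) \<noteq> {\<zero>\<^bsub>K j\<^esub>}} \<and>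
    (\<forall>j. \<exists>B. finite B \<and> B \<subseteq> carrier (K j) \<and>
      (\<forall>x\<in>carrier (K j). \<exists>c. x = (\<Oplus>\<^bsub>K j\<^esub>b\<in>B. c b \<odot>\<^bsub>K j\<^esub> b)))"

locale graded_comm_algebra =
  fixes A :: "int \<Rightarrow> (real, 'a) module"
    and m :: "int \<Rightarrow> int \<Rightarrow> 'a \<Rightarrow> 'a \<Rightarrow> 'a"
    and u :: 'a
  assumes vector_space: "Module.module real_ring (A j)"
    and mult_linear_left:
      "g \<in> carrier (A j) \<Longrightarrow> linear_map (A i) (A (i + j)) (\<lambda>f. m i j f g)"
    and mult_linear_right:
      "f \<in> carrier (A i) \<Longrightarrow> linear_map (A j) (A (i + j)) (m i j f)"
    and mult_assoc:
      "\<lbrakk>f \<in> carrier (A i); g \<in> carrier (A j); h \<in> carrier (A k)\<rbrakk>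
        \<Longrightarrow> m (i + j) k (m i j f g) h = m i (j + k) f (m j k g h)"
    and mult_graded_comm:
      "\<lbrakk>f \<in> carrier (A i); g \<in> carrier (A j)\<rbrakk>
        \<Longrightarrow> m i j f g = (if odd (i * j) then - 1 else 1) \<odot>\<^bsub>A (i + j)\<^esub> m j i g f"
    and unit_closed: "u \<in> carrier (A 0)"
    and unit_left: "f \<in> carrier (A i) \<Longrightarrow> m 0 i u f = f"

locale graded_module =
  fixes A :: "int \<Rightarrow> (real, 'a) module"
    and m :: "int \<Rightarrow> int \<Rightarrow> 'a \<Rightarrow> 'a \<Rightarrow> 'a"
    and u :: 'a
    and P :: "int \<Rightarrow> (real, 'e) module"
    and \<alpha> :: "int \<Rightarrow> int \<Rightarrow> 'a \<Rightarrow> 'e \<Rightarrow> 'e"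
  assumes vector_space: "Module.module real_ring (P j)"
    and act_linear_left:
      "p \<in> carrier (P j) \<Longrightarrow> linear_map (A i) (P (i + j)) (\<lambda>f. \<alpha> i j f p)"
    and act_linear_right:
      "f \<in> carrier (A i) \<Longrightarrow> linear_map (P j) (P (i + j)) (\<alpha> i j f)"
    and act_assoc:
      "\<lbrakk>f \<in> carrier (A i); g \<in> carrier (A j); p \<in> carrier (P k)\<rbrakk>
        \<Longrightarrow> \<alpha> (i + j) k (m i j f g) p = \<alpha> i (j + k) f (\<alpha> j k g p)"
    and act_unit: "p \<in> carrier (P j) \<Longrightarrow> \<alpha> 0 j u p = p"

definition graded_submodule ::
    "(int \<Rightarrow> (real, 'a) module) \<Rightarrow> (int \<Rightarrow> (real, 'e) module) \<Rightarrow>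
     (int \<Rightarrow> int \<Rightarrow> 'a \<Rightarrow> 'e \<Rightarrow> 'e) \<Rightarrow> (int \<Rightarrow> 'e set) \<Rightarrow> bool"
  where "graded_submodule A P \<alpha> N \<longleftrightarrow>
    (\<forall>j. submodule (N j) real_ring (P j)) \<and>
    (\<forall>i j. \<forall>f\<in>carrier (A i). \<forall>p\<in>N j. \<alpha> i j f p \<in> N (i + j))"

definition generated_submodule ::
    "(int \<Rightarrow> (real, 'a) module) \<Rightarrow> (int \<Rightarrow> (real, 'e) module) \<Rightarrow>
     (int \<Rightarrow> int \<Rightarrow> 'a \<Rightarrow> 'e \<Rightarrow> 'e) \<Rightarrow> (int \<Rightarrow> 'e set) \<Rightarrow> int \<Rightarrow> 'e set"
  where "generated_submodule A P \<alpha> S j =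
    \<Inter> {N j | N. graded_submodule A P \<alpha> N \<and> (\<forall>i. S i \<subseteq> N i)}"

primrec ideal_power ::
    "(int \<Rightarrow> (real, 'a) module) \<Rightarrow> (int \<Rightarrow> int \<Rightarrow> 'a \<Rightarrow> 'a \<Rightarrow> 'a) \<Rightarrow>
     (int \<Rightarrow> 'a set) \<Rightarrow> nat \<Rightarrow> int \<Rightarrow> 'a set"
  where
    "ideal_power A m J 0 = (\<lambda>j. carrier (A j))"
  | "ideal_power A m J (Suc q) = generated_submodule A A m
      (\<lambda>j. {m i k f g | i k f g. i + k = j \<and> f \<in> ideal_power A m J q i \<and> g \<in> J k})"

definition ideal_power_submodule ::
    "(int \<Rightarrow> (real, 'a) module) \<Rightarrow> (int \<Rightarrow> int \<Rightarrow> 'a \<Rightarrow> 'a \<Rightarrow> 'a) \<Rightarrow> (int \<Rightarrow> 'a set) \<Rightarrow>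
     (int \<Rightarrow> (real, 'e) module) \<Rightarrow> (int \<Rightarrow> int \<Rightarrow> 'a \<Rightarrow> 'e \<Rightarrow> 'e) \<Rightarrow> nat \<Rightarrow> int \<Rightarrow> 'e set"
  where "ideal_power_submodule A m J P \<alpha> q = generated_submodule A P \<alpha>
    (\<lambda>j. {\<alpha> i k f p | i k f p. i + k = j \<and> f \<in> ideal_power A m J q i \<and> p \<in> carrier (P k)})"


section \<open>Sheaves\<close>

record ('p, 'a) gsheaf =
  sec :: "'p set \<Rightarrow> int \<Rightarrow> (real, 'a) module"
  res :: "'p set \<Rightarrow> 'p set \<Rightarrow> int \<Rightarrow> 'a \<Rightarrow> 'a"

record ('p, 'a) galgebra_sheaf = "('p, 'a) gsheaf" +
  mul :: "'p set \<Rightarrow> int \<Rightarrow> int \<Rightarrow> 'a \<Rightarrow> 'a \<Rightarrow> 'a"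
  unit :: "'p set \<Rightarrow> 'a"

record ('p, 'a, 'e) gmodule_sheaf = "('p, 'e) gsheaf" +
  act :: "'p set \<Rightarrow> int \<Rightarrow> int \<Rightarrow> 'a \<Rightarrow> 'e \<Rightarrow> 'e"

locale sheaf_of_graded_vector_spaces =
  fixes M :: "'p topology" and F :: "('p, 'a, 'z) gsheaf_scheme"
  assumes sec_vector_space: "openin M U \<Longrightarrow> Module.module real_ring (sec F U j)"
    and res_linear:
      "\<lbrakk>openin M U; openin M V; V \<subseteq> U\<rbrakk> \<Longrightarrow> linear_map (sec F U j) (sec F V j) (res F U V j)"
    and res_id: "\<lbrakk>openin M U; s \<in> carrier (sec F U j)\<rbrakk> \<Longrightarrow> res F U U j s = s"
    and res_comp:
      "\<lbrakk>openin M U; openin M V; openin M W; V \<subseteq> U; W \<subseteq> V; s \<in> carrier (sec F U j)\<rbrakk>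
        \<Longrightarrow> res F V W j (res F U V j s) = res F U W j s"
    and locality:
      "\<lbrakk>\<forall>V\<in>\<U>. openin M V; s \<in> carrier (sec F (\<Union>\<U>) j); t \<in> carrier (sec F (\<Union>\<U>) j);
        \<forall>V\<in>\<U>. res F (\<Union>\<U>) V j s = res F (\<Union>\<U>) V j t\<rbrakk> \<Longrightarrow> s = t"
    and gluing:
      "\<lbrakk>\<forall>V\<in>\<U>. openin M V; \<forall>V\<in>\<U>. \<sigma> V \<in> carrier (sec F V j);
        \<forall>V\<in>\<U>. \<forall>W\<in>\<U>. res F V (V \<inter> W) j (\<sigma> V) = res F W (V \<inter> W) j (\<sigma> W)\<rbrakk>
        \<Longrightarrow> \<exists>s\<in>carrier (sec F (\<Union>\<U>) j). \<forall>V\<in>\<U>. res F (\<Union>\<U>) V j s = \<sigma> V"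

locale sheaf_of_graded_algebras = sheaf_of_graded_vector_spaces M \<O>
  for M :: "'p topology" and \<O> :: "('p, 'a) galgebra_sheaf" +
  assumes sec_algebra:
      "openin M U \<Longrightarrow> graded_comm_algebra (sec \<O> U) (mul \<O> U) (unit \<O> U)"
    and res_mul:
      "\<lbrakk>openin M U; openin M V; V \<subseteq> U; f \<in> carrier (sec \<O> U i); g \<in> carrier (sec \<O> U j)\<rbrakk>
        \<Longrightarrow> res \<O> U V (i + j) (mul \<O> U i j f g) = mul \<O> V i j (res \<O> U V i f) (res \<O> U V j g)"
    and res_unit:
      "\<lbrakk>openin M U; openin M V; V \<subseteq> U\<rbrakk> \<Longrightarrow> res \<O> U V 0 (unit \<O> U) = unit \<O> V"

locale sheaf_of_graded_modules = sheaf_of_graded_vector_spaces M E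
  for M :: "'p topology" and \<O> :: "('p, 'a) galgebra_sheaf"
    and E :: "('p, 'a, 'e) gmodule_sheaf" +
  assumes sec_module:
      "openin M U \<Longrightarrow>
        graded_module (sec \<O> U) (mul \<O> U) (unit \<O> U) (sec E U) (act E U)"
    and res_act:
      "\<lbrakk>openin M U; openin M V; V \<subseteq> U; f \<in> carrier (sec \<O> U i); s \<in> carrier (sec E U j)\<rbrakk>
        \<Longrightarrow> res E U V (i + j) (act E U i j f s) = act E V i j (res \<O> U V i f) (res E U V j s)"

text \<open>
  An isomorphism between the restriction of \<open>F\<close> to the open set \<open>V\<close> and a sheaf \<open>G\<close> on the image
  of \<open>V\<close> under an open embedding \<open>\<phi>\<close>: a natural family of linear bijections
  \<open>F(W) \<rightarrow> G(\<phi>(W))\<close> for \<open>W \<subseteq> V\<close> open.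
\<close>

definition gsheaf_iso ::
    "'p topology \<Rightarrow> 'p set \<Rightarrow> ('p \<Rightarrow> 'r) \<Rightarrow> ('p, 'a, 'y) gsheaf_scheme \<Rightarrow>
     ('r, 'b, 'z) gsheaf_scheme \<Rightarrow> ('p set \<Rightarrow> int \<Rightarrow> 'a \<Rightarrow> 'b) \<Rightarrow> bool"
  where "gsheaf_iso M V \<phi> F G \<Phi> \<longleftrightarrow>
    (\<forall>W j. openin M W \<and> W \<subseteq> V \<longrightarrow>
      linear_map (sec F W j) (sec G (\<phi> ` W) j) (\<Phi> W j) \<and>
      bij_betw (\<Phi> W j) (carrier (sec F W j)) (carrier (sec G (\<phi> ` W) j))) \<and>
    (\<forall>W W' j. openin M W \<and> openin M W' \<and> W' \<subseteq> W \<and> W \<subseteq> V \<longrightarrow>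
      (\<forall>s\<in>carrier (sec F W j).
        \<Phi> W' j (res F W W' j s) = res G (\<phi> ` W) (\<phi> ` W') j (\<Phi> W j s)))"

definition galgebra_sheaf_iso ::
    "'p topology \<Rightarrow> 'p set \<Rightarrow> ('p \<Rightarrow> 'r) \<Rightarrow> ('p, 'a) galgebra_sheaf \<Rightarrow>
     ('r, 'b) galgebra_sheaf \<Rightarrow> ('p set \<Rightarrow> int \<Rightarrow> 'a \<Rightarrow> 'b) \<Rightarrow> bool"
  where "galgebra_sheaf_iso M V \<phi> \<O> \<O>' \<Phi> \<longleftrightarrow>
    gsheaf_iso M V \<phi> \<O> \<O>' \<Phi> \<and>
    (\<forall>W. openin M W \<and> W \<subseteq> V \<longrightarrow>
      \<Phi> W 0 (unit \<O> W) = unit \<O>' (\<phi> ` W) \<and>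
      (\<forall>i j. \<forall>f\<in>carrier (sec \<O> W i). \<forall>g\<in>carrier (sec \<O> W j).
        \<Phi> W (i + j) (mul \<O> W i j f g) = mul \<O>' (\<phi> ` W) i j (\<Phi> W i f) (\<Phi> W j g)))"

definition gmodule_sheaf_iso ::
    "'p topology \<Rightarrow> 'p set \<Rightarrow> ('p, 'a) galgebra_sheaf \<Rightarrow> ('p, 'a, 'e) gmodule_sheaf \<Rightarrow>
     ('p, 'a, 'd) gmodule_sheaf \<Rightarrow> ('p set \<Rightarrow> int \<Rightarrow> 'e \<Rightarrow> 'd) \<Rightarrow> bool"
  where "gmodule_sheaf_iso M V \<O> E E' \<Psi> \<longleftrightarrow>
    gsheaf_iso M V (\<lambda>x. x) E E' \<Psi> \<and>
    (\<forall>W. openin M W \<and> W \<subseteq> V \<longrightarrow>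
      (\<forall>i j. \<forall>f\<in>carrier (sec \<O> W i). \<forall>s\<in>carrier (sec E W j).
        \<Psi> W (i + j) (act E W i j f s) = act E' W i j f (\<Psi> W j s)))"


section \<open>The local model\<close>

text \<open>
  \<open>Euclidean_space n\<close> consists of the functions \<open>nat \<Rightarrow> real\<close> vanishing at all \<open>i \<ge> n\<close>, so that the
  dimension \<open>n\<close> (possibly \<open>0\<close>) is a term. Smoothness means that all iterated partial derivatives
  exist and are continuous on the open set \<open>U\<close>.
\<close>

definition partial_deriv :: "nat \<Rightarrow> ((nat \<Rightarrow> real) \<Rightarrow> real) \<Rightarrow> (nat \<Rightarrow> real) \<Rightarrow> real"
  where "partial_deriv i f x = deriv (\<lambda>t. f (x(i := t))) (x i)"

primrec times_cont_diff :: "nat \<Rightarrow> (nat \<Rightarrow> real) set \<Rightarrow> nat \<Rightarrow> ((nat \<Rightarrow> real) \<Rightarrow> real) \<Rightarrow> bool"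
  where
    "times_cont_diff n U 0 f \<longleftrightarrow>
      continuous_map (subtopology (Euclidean_space n) U) euclideanreal f"
  | "times_cont_diff n U (Suc k) f \<longleftrightarrow>
      continuous_map (subtopology (Euclidean_space n) U) euclideanreal f \<and>
      (\<forall>i<n. (\<forall>x\<in>U. (\<lambda>t. f (x(i := t))) differentiable (at (x i))) \<and>
             times_cont_diff n U k (partial_deriv i f))"

definition smooth_fun_on :: "nat \<Rightarrow> (nat \<Rightarrow> real) set \<Rightarrow> ((nat \<Rightarrow> real) \<Rightarrow> real) \<Rightarrow> bool"
  where "smooth_fun_on n U f \<longleftrightarrow> (\<forall>k. times_cont_diff n U k f)"

text \<open>
  The graded variables \<open>\<xi>\<^sub>0, \<dots>, \<xi>\<^sub>N\<^sub>-\<^sub>1\<close> are given by the list \<open>ds\<close> of their degrees, so \<open>n\<^sub>j\<close> is the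
  number of occurrences of \<open>j\<close> in \<open>ds\<close>. A monomial \<open>\<xi>\<^sup>p\<close> stands for
  \<open>\<xi>\<^sub>0\<^bsup>p 0\<^esup> \<xi>\<^sub>1\<^bsup>p 1\<^esup> \<dots>\<close> in this order; odd variables square to zero.
\<close>

definition multi_indices :: "int list \<Rightarrow> (nat \<Rightarrow> nat) set"
  where "multi_indices ds =
    {p. (\<forall>i\<ge>length ds. p i = 0) \<and> (\<forall>i<length ds. odd (ds ! i) \<longrightarrow> p i \<le> 1)}"

definition monomial_degree :: "int list \<Rightarrow> (nat \<Rightarrow> nat) \<Rightarrow> int"
  where "monomial_degree ds p = (\<Sum>i<length ds. int (p i) * ds ! i)"

text \<open>
  \<open>\<xi>\<^sup>q \<xi>\<^sup>r = monomial_sign ds q r * \<xi>\<^sup>q\<^sup>+\<^sup>r\<close>: sorting the product moves the factors \<open>\<xi>\<^sub>l\<close> of \<open>\<xi>\<^sup>r\<close> to the left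
  past the factors \<open>\<xi>\<^sub>k\<close> of \<open>\<xi>\<^sup>q\<close> with \<open>k > l\<close>. Only the parity of the exponent matters, hence the
  absolute value.
\<close>

definition monomial_sign :: "int list \<Rightarrow> (nat \<Rightarrow> nat) \<Rightarrow> (nat \<Rightarrow> nat) \<Rightarrow> real"
  where "monomial_sign ds q r =
    (- 1) ^ (\<Sum>k<length ds. \<Sum>l<k. q k * r l * nat \<bar>ds ! k * ds ! l\<bar>)"

type_synonym power_series = "(nat \<Rightarrow> nat) \<Rightarrow> (nat \<Rightarrow> real) \<Rightarrow> real"

text \<open>
  A series \<open>\<Sum>\<^sub>p f\<^sub>p \<xi>\<^sup>p\<close> over \<open>U\<close> is the family of its coefficient functions \<open>f\<^sub>p\<close>, each normalised to
  be \<open>0\<close> outside \<open>U\<close>; this makes the representation of a function on \<open>U\<close> unique.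
\<close>

definition model_series :: "nat \<Rightarrow> int list \<Rightarrow> (nat \<Rightarrow> real) set \<Rightarrow> int \<Rightarrow> power_series set"
  where "model_series n ds U j =
    {f. (\<forall>p. smooth_fun_on n U (f p)) \<and> (\<forall>p. \<forall>x. x \<notin> U \<longrightarrow> f p x = 0) \<and>
        (\<forall>p. \<not> (p \<in> multi_indices ds \<and> monomial_degree ds p = j) \<longrightarrow> (\<forall>x. f p x = 0))}"

definition series_mult :: "int list \<Rightarrow> power_series \<Rightarrow> power_series \<Rightarrow> power_series"
  where "series_mult ds f g = (\<lambda>p x.
    if p \<in> multi_indices ds
    then \<Sum>q | \<forall>i. q i \<le> p i.
           monomial_sign ds q (\<lambda>i. p i - q i) * f q x * g (\<lambda>i. p i - q i) x
    else 0)"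

definition model_sheaf :: "nat \<Rightarrow> int list \<Rightarrow> (nat \<Rightarrow> real, power_series) galgebra_sheaf"
  where "model_sheaf n ds =
    \<lparr>sec = (\<lambda>U j. \<lparr>carrier = model_series n ds U j, mult = undefined, one = undefined,
                    zero = (\<lambda>p x. 0), add = (\<lambda>f g p x. f p x + g p x),
                    smult = (\<lambda>r f p x. r * f p x)\<rparr>),
     res = (\<lambda>U V j f p x. if x \<in> V then f p x else 0),
     mul = (\<lambda>U i j. series_mult ds),
     unit = (\<lambda>U p x. if p = (\<lambda>_. 0) \<and> x \<in> U then 1 else 0)\<rparr>"


section \<open>Graded manifolds\<close>

definition second_countable_space :: "'p topology \<Rightarrow> bool"
  where "second_countable_space M \<longleftrightarrow>
    (\<exists>\<B>. countable \<B> \<and> (\<forall>B\<in>\<B>. openin M B) \<and>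
      (\<forall>U x. openin M U \<and> x \<in> U \<longrightarrow> (\<exists>B\<in>\<B>. x \<in> B \<and> B \<subseteq> U)))"

definition graded_chart ::
    "'p topology \<Rightarrow> ('p, 'a) galgebra_sheaf \<Rightarrow> nat \<Rightarrow> int list \<Rightarrow> 'p set \<Rightarrow>
     ('p \<Rightarrow> nat \<Rightarrow> real) \<Rightarrow> ('p set \<Rightarrow> int \<Rightarrow> 'a \<Rightarrow> power_series) \<Rightarrow> bool"
  where "graded_chart M \<O> n ds V \<phi> \<Phi> \<longleftrightarrow>
    openin M V \<and> openin (Euclidean_space n) (\<phi> ` V) \<and>
    homeomorphic_map (subtopology M V) (subtopology (Euclidean_space n) (\<phi> ` V)) \<phi> \<and>
    galgebra_sheaf_iso M V \<phi> \<O> (model_sheaf n ds) \<Phi>"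

text \<open>A graded manifold \<open>(M, \<O>)\<close> with \<open>n\<close> coordinates of degree \<open>0\<close> and further ones of degrees \<open>ds\<close>.\<close>

definition graded_manifold ::
    "'p topology \<Rightarrow> ('p, 'a) galgebra_sheaf \<Rightarrow> nat \<Rightarrow> int list \<Rightarrow> bool"
  where "graded_manifold M \<O> n ds \<longleftrightarrow>
    Hausdorff_space M \<and> second_countable_space M \<and>
    sheaf_of_graded_algebras M \<O> \<and> 0 \<notin> set ds \<and>
    (\<forall>x\<in>topspace M. \<exists>V \<phi> \<Phi>. x \<in> V \<and> graded_chart M \<O> n ds V \<phi> \<Phi>)"

text \<open>
  The value at \<open>x \<in> U\<close> of the body of \<open>f\<close> (a function over \<open>U\<close> of degree \<open>j\<close>), read off as the
  coefficient of \<open>\<xi>\<^sup>0\<close> in a chart around \<open>x\<close>. It does not depend on the chart: for \<open>j = 0\<close> it is the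
  only \<open>r\<close> such that \<open>f - r\<close> is not invertible on any neighbourhood of \<open>x\<close>; for \<open>j \<noteq> 0\<close> it is \<open>0\<close>
  as \<open>\<xi>\<^sup>0\<close> has degree \<open>0\<close>.
\<close>

definition body ::
    "'p topology \<Rightarrow> ('p, 'a) galgebra_sheaf \<Rightarrow> nat \<Rightarrow> int list \<Rightarrow> 'p set \<Rightarrow> int \<Rightarrow> 'a \<Rightarrow> 'p \<Rightarrow> real"
  where "body M \<O> n ds U j f x =
    (THE r. \<exists>V \<phi> \<Phi>. graded_chart M \<O> n ds V \<phi> \<Phi> \<and> x \<in> V \<and> V \<subseteq> U \<and>
       r = \<Phi> V j (res \<O> U V j f) (\<lambda>_. 0) (\<phi> x))"

definition vanishing_ideal ::
    "'p topology \<Rightarrow> ('p, 'a) galgebra_sheaf \<Rightarrow> nat \<Rightarrow> int list \<Rightarrow> 'p set \<Rightarrow> 'p \<Rightarrow> int \<Rightarrow> 'a set"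
  where "vanishing_ideal M \<O> n ds U a j = {f \<in> carrier (sec \<O> U j). body M \<O> n ds U j f a = 0}"


section \<open>Graded vector bundles\<close>

text \<open>
  The tensor product over the reals of graded vector spaces \<open>A\<close> and \<open>K\<close>. Elements of degree \<open>j\<close> are
  finite formal sums of elementary tensors, given as multisets of triples \<open>(i, f, k)\<close> with \<open>f\<close> of
  degree \<open>i\<close> and \<open>k\<close> of degree \<open>j - i\<close>, modulo the congruence generated by bilinearity.
\<close>

type_synonym ('a, 'k) formal_tensor = "(int \<times> 'a \<times> 'k) multiset"

definition elementary_tensors ::
    "(int \<Rightarrow> (real, 'a) module) \<Rightarrow> (int \<Rightarrow> (real, 'k) module) \<Rightarrow> int \<Rightarrow> (int \<times> 'a \<times> 'k) set"
  where "elementary_tensors A K j =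
    {(i, f, k). f \<in> carrier (A i) \<and> k \<in> carrier (K (j - i))}"

inductive tensor_eq ::
    "(int \<Rightarrow> (real, 'a) module) \<Rightarrow> (int \<Rightarrow> (real, 'k) module) \<Rightarrow> int \<Rightarrow>
     ('a, 'k) formal_tensor \<Rightarrow> ('a, 'k) formal_tensor \<Rightarrow> bool"
  for A :: "int \<Rightarrow> (real, 'a) module" and K :: "int \<Rightarrow> (real, 'k) module" and j :: int
  where
    refl: "set_mset x \<subseteq> elementary_tensors A K j \<Longrightarrow> tensor_eq A K j x x"
  | sym: "tensor_eq A K j x y \<Longrightarrow> tensor_eq A K j y x"
  | trans: "tensor_eq A K j x y \<Longrightarrow> tensor_eq A K j y z \<Longrightarrow> tensor_eq A K j x z"
  | cong: "tensor_eq A K j x y \<Longrightarrow> t \<in> elementary_tensors A K j \<Longrightarrow>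
      tensor_eq A K j (add_mset t x) (add_mset t y)"
  | zero: "k \<in> carrier (K (j - i)) \<Longrightarrow> tensor_eq A K j {#(i, \<zero>\<^bsub>A i\<^esub>, k)#} {#}"
  | add_left:
      "\<lbrakk>f \<in> carrier (A i); g \<in> carrier (A i); k \<in> carrier (K (j - i))\<rbrakk>
        \<Longrightarrow> tensor_eq A K j {#(i, f \<oplus>\<^bsub>A i\<^esub> g, k)#} {#(i, f, k), (i, g, k)#}"
  | add_right:
      "\<lbrakk>f \<in> carrier (A i); k \<in> carrier (K (j - i)); l \<in> carrier (K (j - i))\<rbrakk>
        \<Longrightarrow> tensor_eq A K j {#(i, f, k \<oplus>\<^bsub>K (j - i)\<^esub> l)#} {#(i, f, k), (i, f, l)#}"
  | balanced:
      "\<lbrakk>f \<in> carrier (A i); k \<in> carrier (K (j - i))\<rbrakk>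
        \<Longrightarrow> tensor_eq A K j {#(i, r \<odot>\<^bsub>A i\<^esub> f, k)#} {#(i, f, r \<odot>\<^bsub>K (j - i)\<^esub> k)#}"

definition tensor_class ::
    "(int \<Rightarrow> (real, 'a) module) \<Rightarrow> (int \<Rightarrow> (real, 'k) module) \<Rightarrow> int \<Rightarrow>
     ('a, 'k) formal_tensor \<Rightarrow> ('a, 'k) formal_tensor set"
  where "tensor_class A K j x = {y. tensor_eq A K j x y}"

text \<open>The map induced on classes by a map of elementary tensors.\<close>

definition tensor_lift ::
    "(int \<Rightarrow> (real, 'a) module) \<Rightarrow> (int \<Rightarrow> (real, 'k) module) \<Rightarrow> int \<Rightarrow>
     (int \<times> 'a \<times> 'k \<Rightarrow> int \<times> 'a \<times> 'k) \<Rightarrow>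
     ('a, 'k) formal_tensor set \<Rightarrow> ('a, 'k) formal_tensor set"
  where "tensor_lift A K j h C = (\<Union>x\<in>C. tensor_class A K j (image_mset h x))"

definition tensor_space ::
    "(int \<Rightarrow> (real, 'a) module) \<Rightarrow> (int \<Rightarrow> (real, 'k) module) \<Rightarrow> int \<Rightarrow>
     (real, ('a, 'k) formal_tensor set) module"
  where "tensor_space A K j =
    \<lparr>carrier = {tensor_class A K j x | x. set_mset x \<subseteq> elementary_tensors A K j},
     mult = undefined, one = undefined,
     zero = tensor_class A K j {#},
     add = (\<lambda>C D. \<Union>x\<in>C. \<Union>y\<in>D. tensor_class A K j (x + y)),
     smult = (\<lambda>r. tensor_lift A K j (\<lambda>(i, f, k). (i, r \<odot>\<^bsub>A i\<^esub> f, k)))\<rparr>"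

definition tensor_sheaf ::
    "('p, 'a) galgebra_sheaf \<Rightarrow> (int \<Rightarrow> (real, 'k) module) \<Rightarrow>
     ('p, 'a, ('a, 'k) formal_tensor set) gmodule_sheaf"
  where "tensor_sheaf \<O> K =
    \<lparr>sec = (\<lambda>U. tensor_space (sec \<O> U) K),
     res = (\<lambda>U V j. tensor_lift (sec \<O> V) K j (\<lambda>(i, f, k). (i, res \<O> U V i f, k))),
     act = (\<lambda>U l j f.
       tensor_lift (sec \<O> U) K (l + j) (\<lambda>(i, g, k). (l + i, mul \<O> U l i f g, k)))\<rparr>"

text \<open>\<open>E\<close> is the sheaf of sections of a graded vector bundle with typical fibre \<open>K\<close>.\<close>

definition graded_vector_bundle ::
    "'p topology \<Rightarrow> ('p, 'a) galgebra_sheaf \<Rightarrow> (int \<Rightarrow> (real, 'k) module) \<Rightarrow>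
     ('p, 'a, 'e) gmodule_sheaf \<Rightarrow> bool"
  where "graded_vector_bundle M \<O> K E \<longleftrightarrow>
    sheaf_of_graded_modules M \<O> E \<and> finite_dim_graded K \<and>
    (\<forall>x\<in>topspace M. \<exists>V \<Psi>. openin M V \<and> x \<in> V \<and>
      gmodule_sheaf_iso M V \<O> E (tensor_sheaf \<O> K) \<Psi>)"


section \<open>Geometric modules and presheaves\<close>

text \<open>
  For \<open>U = {}\<close> the intersection defining \<open>P\<^sup>\<bullet>\<close> is over the empty family of submodules of \<open>P\<close>, hence
  all of \<open>P\<close>.
\<close>

definition invisible_part ::
    "'p topology \<Rightarrow> ('p, 'a) galgebra_sheaf \<Rightarrow> nat \<Rightarrow> int list \<Rightarrow> 'p set \<Rightarrow>
     (int \<Rightarrow> (real, 'e) module) \<Rightarrow> (int \<Rightarrow> int \<Rightarrow> 'a \<Rightarrow> 'e \<Rightarrow> 'e) \<Rightarrow> int \<Rightarrow> 'e set"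
  where "invisible_part M \<O> n ds U P \<alpha> j =
    {p \<in> carrier (P j). \<forall>q. \<forall>a\<in>U.
       p \<in> ideal_power_submodule (sec \<O> U) (mul \<O> U) (vanishing_ideal M \<O> n ds U a) P \<alpha> q j}"

definition geometric_module ::
    "'p topology \<Rightarrow> ('p, 'a) galgebra_sheaf \<Rightarrow> nat \<Rightarrow> int list \<Rightarrow> 'p set \<Rightarrow>
     (int \<Rightarrow> (real, 'e) module) \<Rightarrow> (int \<Rightarrow> int \<Rightarrow> 'a \<Rightarrow> 'e \<Rightarrow> 'e) \<Rightarrow> bool"
  where "geometric_module M \<O> n ds U P \<alpha> \<longleftrightarrow>
    (\<forall>j. invisible_part M \<O> n ds U P \<alpha> j = {\<zero>\<^bsub>P j\<^esub>})"

definition geometric ::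
    "'p topology \<Rightarrow> ('p, 'a) galgebra_sheaf \<Rightarrow> nat \<Rightarrow> int list \<Rightarrow>
     ('p, 'a, 'e) gmodule_sheaf \<Rightarrow> bool"
  where "geometric M \<O> n ds E \<longleftrightarrow>
    (\<forall>U. openin M U \<longrightarrow> geometric_module M \<O> n ds U (sec E U) (act E U))"

end

theory Submission
  imports Defs
begin

text \<open>
  By locality, a section \<open>s\<close> over \<open>U\<close> vanishes if it vanishes on each member of a cover of \<open>U\<close> by
  domains \<open>W\<close> of charts over which the bundle is trivial. Over such a \<open>W\<close> the section is a tensor in
  \<open>\<O>(W) \<otimes> K\<close>, and a tensor is zero once its contractions with all linear functionals on the
  finite-dimensional summands of \<open>K\<close> are zero (\<open>tensor_eq_emptyI\<close>). These contractions are functions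
  on \<open>W\<close>, that is, power series in the graded variables with smooth coefficients.

  Fix \<open>a\<close> in \<open>W\<close>. Functions whose coefficients at \<open>a\<close> vanish in all total degrees below \<open>q\<close> form an
  ideal. It contains the \<open>q\<close>-th power of the vanishing ideal of \<open>a\<close>, because a factor with vanishing
  constant term at \<open>a\<close> raises the order by one (\<open>series_mult_eq_zero_Suc\<close>); no derivatives of the
  coefficients are needed. Contractions are linear over the functions, so those of a section in
  \<open>P\<^bsup>[q,a]\<^esup>\<close> lie in this ideal (\<open>ideal_power_submodule_subset\<close>). If \<open>s\<close> lies in \<open>P\<^bsup>[q,a]\<^esup>\<close> for all \<open>q\<close>
  and all \<open>a\<close>, then every coefficient of every contraction vanishes at every point of \<open>W\<close>.

  The vanishing ideal is defined through the body, hence the argument needs that the body can be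
  computed in any chart (\<open>body_eq\<close>). If the values of a function of degree \<open>0\<close> in two charts differed
  at a point, then after subtraction of a constant the function would vanish there in one chart and
  not in the other. But a series with nonzero constant term has an inverse, given by a recursion
  over the multi-indices (\<open>inverse_series\<close>), so the function would be invertible near the point, and
  its value could vanish in no chart.
\<close>

section \<open>Smooth functions\<close>

lemma eventually_fun_upd_in_open:
  assumes "openin (Euclidean_space n) U" "x \<in> U" "i < n"
  shows "\<forall>\<^sub>F t in nhds (x i). x(i := t) \<in> U"
proof -
  have "x \<in> topspace (Euclidean_space n)"
    using assms openin_subset by blast
  then have "continuous_map euclideanreal (Euclidean_space n) (\<lambda>t. x(i := t))"
    using \<open>i < n\<close>
    by (auto simp: Euclidean_space_def continuous_map_in_subtopology
        continuous_map_componentwise_UNIV fun_upd_def)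
  then have "openin euclideanreal {t \<in> topspace euclideanreal. x(i := t) \<in> U}"
    using assms(1) openin_continuous_map_preimage by blast
  then show ?thesis
    using \<open>x \<in> U\<close> by (auto simp: eventually_nhds intro!: exI[of _ "{t. x(i := t) \<in> U}"])
qed

lemma times_cont_diff_has_partial_deriv:
  assumes "times_cont_diff n U (Suc k) f" "x \<in> U" "i < n"
  shows "((\<lambda>t. f (x(i := t))) has_real_derivative partial_deriv i f x) (at (x i))"
proof -
  obtain D where "((\<lambda>t. f (x(i := t))) has_real_derivative D) (at (x i))"
    using assms real_differentiableE by (metis times_cont_diff.simps(2))
  then show ?thesis
    unfolding partial_deriv_def by (simp add: DERIV_imp_deriv)
qed

lemma times_cont_diff_cong:
  assumes "openin (Euclidean_space n) U"
    and "times_cont_diff n U k f" "\<And>x. x \<in> U \<Longrightarrow> f x = g x"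
  shows "times_cont_diff n U k g"
  using assms(2,3)
proof (induction k arbitrary: f g)
  case 0
  then show ?case
    by (auto intro: continuous_map_eq)
next
  case (Suc k)
  have ev: "\<forall>\<^sub>F t in nhds (x i). f (x(i := t)) = g (x(i := t))" if "x \<in> U" "i < n" for x i
    using eventually_fun_upd_in_open[OF assms(1) that]
    by eventually_elim (use Suc.prems in auto)
  have "(\<lambda>t. g (x(i := t))) differentiable at (x i)" if "x \<in> U" "i < n" for x i
  proof -
    have "((\<lambda>t. f (x(i := t))) has_real_derivative partial_deriv i f x) (at (x i))"
      using Suc.prems(1) that by (rule times_cont_diff_has_partial_deriv)
    then have "((\<lambda>t. g (x(i := t))) has_real_derivative partial_deriv i f x) (at (x i))"
      using DERIV_cong_ev[OF HOL.refl ev[OF that] HOL.refl] by simp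
    then show ?thesis
      using real_differentiable_def by blast
  qed
  moreover have "times_cont_diff n U k (partial_deriv i g)" if "i < n" for i
  proof (rule Suc.IH)
    show "times_cont_diff n U k (partial_deriv i f)"
      using Suc.prems(1) that by simp
    show "partial_deriv i f x = partial_deriv i g x" if "x \<in> U" for x
      unfolding partial_deriv_def using ev[OF that \<open>i < n\<close>] by (intro deriv_cong_ev) auto
  qed
  moreover have "continuous_map (subtopology (Euclidean_space n) U) euclideanreal g"
    using Suc.prems by (auto intro: continuous_map_eq)
  ultimately show ?case
    by simp
qed

lemma times_cont_diff_Suc_imp: "times_cont_diff n U (Suc k) f \<Longrightarrow> times_cont_diff n U k f"
proof (induction k arbitrary: f)
  case (Suc k)
  then have "times_cont_diff n U k (partial_deriv i f)" if "i < n" for i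
    using that by (metis times_cont_diff.simps(2))
  then show ?case
    using Suc.prems by auto
qed auto

text \<open>Differentiability can be shown with explicit derivatives in place of \<open>partial_deriv\<close>.\<close>

lemma times_cont_diff_SucI:
  assumes "openin (Euclidean_space n) U"
    and "continuous_map (subtopology (Euclidean_space n) U) euclideanreal f"
    and "\<And>i x. i < n \<Longrightarrow> x \<in> U \<Longrightarrow> ((\<lambda>t. f (x(i := t))) has_real_derivative f' i x) (at (x i))"
    and "\<And>i. i < n \<Longrightarrow> times_cont_diff n U k (f' i)"
  shows "times_cont_diff n U (Suc k) f"
proof -
  have "times_cont_diff n U k (partial_deriv i f)" if "i < n" for i
    using assms(1) assms(4)[OF that]
  proof (rule times_cont_diff_cong)
    show "f' i x = partial_deriv i f x" if "x \<in> U" for x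
      unfolding partial_deriv_def using assms(3)[OF \<open>i < n\<close> that] by (simp add: DERIV_imp_deriv)
  qed
  then show ?thesis
    using assms(2,3) real_differentiable_def by (simp, blast)
qed

lemma times_cont_diff_const:
  assumes "openin (Euclidean_space n) U"
  shows "times_cont_diff n U k (\<lambda>x. c)"
proof (induction k arbitrary: c)
  case (Suc k)
  show ?case
    by (rule times_cont_diff_SucI[OF assms, where f' = "\<lambda>_ _. 0"]) (auto simp: Suc)
qed auto

lemma times_cont_diff_add:
  assumes "openin (Euclidean_space n) U"
    and "times_cont_diff n U k f" "times_cont_diff n U k g"
  shows "times_cont_diff n U k (\<lambda>x. f x + g x)"
  using assms(2,3)
proof (induction k arbitrary: f g)
  case (Suc k)
  show ?case
  proof (rule times_cont_diff_SucI[OF assms(1)])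
    fix i x assume "i < n" "x \<in> U"
    then show "((\<lambda>t. f (x(i := t)) + g (x(i := t))) has_real_derivative
        partial_deriv i f x + partial_deriv i g x) (at (x i))"
      using Suc.prems by (intro DERIV_add times_cont_diff_has_partial_deriv)
  qed (use Suc in \<open>auto intro: continuous_map_add\<close>)
qed (auto intro: continuous_map_add)

lemma times_cont_diff_mult:
  assumes "openin (Euclidean_space n) U"
    and "times_cont_diff n U k f" "times_cont_diff n U k g"
  shows "times_cont_diff n U k (\<lambda>x. f x * g x)"
  using assms(2,3)
proof (induction k arbitrary: f g)
  case (Suc k)
  show ?case
  proof (rule times_cont_diff_SucI[OF assms(1)])
    fix i x assume "i < n" "x \<in> U"
    then show "((\<lambda>t. f (x(i := t)) * g (x(i := t))) has_real_derivative
        partial_deriv i f x * g x + partial_deriv i g x * f x) (at (x i))"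
      using DERIV_mult[OF times_cont_diff_has_partial_deriv[OF Suc.prems(1)]
          times_cont_diff_has_partial_deriv[OF Suc.prems(2)], of x i x i]
      by (simp only: fun_upd_triv)
  next
    fix i assume "i < n"
    then show "times_cont_diff n U k (\<lambda>x. partial_deriv i f x * g x + partial_deriv i g x * f x)"
      using Suc.prems Suc.prems[THEN times_cont_diff_Suc_imp]
      by (auto intro!: times_cont_diff_add[OF assms(1)] Suc.IH simp del: fun_upd_apply)
  qed (use Suc.prems in \<open>auto intro: continuous_map_real_mult\<close>)
qed (auto intro: continuous_map_real_mult)

lemma times_cont_diff_inverse:
  assumes "openin (Euclidean_space n) U"
    and "times_cont_diff n U k f" and nz: "\<And>x. x \<in> U \<Longrightarrow> f x \<noteq> 0"
  shows "times_cont_diff n U k (\<lambda>x. inverse (f x))"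
  using assms(2)
proof (induction k)
  case (Suc k)
  have IH: "times_cont_diff n U k (\<lambda>x. inverse (f x))"
    using Suc.IH Suc.prems times_cont_diff_Suc_imp[of n U k f] by simp
  show ?case
  proof (rule times_cont_diff_SucI[OF assms(1)])
    fix i x assume "i < n" "x \<in> U"
    then show "((\<lambda>t. inverse (f (x(i := t)))) has_real_derivative
        (- 1) * (partial_deriv i f x * (inverse (f x) * inverse (f x)))) (at (x i))"
      using Suc.prems nz DERIV_inverse_fun[OF times_cont_diff_has_partial_deriv, of n U k f x i]
      by (auto simp: numeral_2_eq_2)
  next
    fix i assume "i < n"
    then show "times_cont_diff n U k
        (\<lambda>x. (- 1) * (partial_deriv i f x * (inverse (f x) * inverse (f x))))"
      using Suc.prems IH
      by (intro times_cont_diff_mult times_cont_diff_const assms(1)) auto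
  qed (use Suc nz in \<open>auto intro!: continuous_map_real_inverse\<close>)
qed (use nz in \<open>auto intro!: continuous_map_real_inverse\<close>)

lemma smooth_fun_on_sum:
  assumes "openin (Euclidean_space n) U" "\<And>i. i \<in> I \<Longrightarrow> smooth_fun_on n U (f i)"
  shows "smooth_fun_on n U (\<lambda>x. \<Sum>i\<in>I. f i x)"
proof (cases "finite I")
  case True
  then show ?thesis
    using assms(2)
    by (induction I)
      (auto simp: smooth_fun_on_def intro: times_cont_diff_add times_cont_diff_const assms(1))
qed (simp add: smooth_fun_on_def times_cont_diff_const assms(1))

section \<open>Inverses of power series\<close>

text \<open>
  The total degree of \<open>\<xi>\<^sup>p\<close>, in which each variable counts as \<open>1\<close>; \<open>monomial_degree\<close> takes the degrees
  of the variables into account instead.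
\<close>

definition monomial_size :: "int list \<Rightarrow> (nat \<Rightarrow> nat) \<Rightarrow> nat"
  where "monomial_size ds p = (\<Sum>i<length ds. p i)"

lemma finite_multi_index_le:
  assumes "p \<in> multi_indices ds"
  shows "finite {q. \<forall>i. q i \<le> p i}"
proof (rule finite_subset)
  show "{q. \<forall>i. q i \<le> p i} \<subseteq> {q. \<forall>i. (i \<in> {..<length ds} \<longrightarrow> q i \<in> {..sum p {..<length ds}}) \<and>
      (i \<notin> {..<length ds} \<longrightarrow> q i = 0)}"
  proof (intro subsetI CollectI allI conjI impI)
    fix q i assume q: "q \<in> {q. \<forall>i. q i \<le> p i}"
    show "q i \<in> {..sum p {..<length ds}}" if "i \<in> {..<length ds}"
      using q that member_le_sum[of i "{..<length ds}" p] by (auto intro: order.trans)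
    show "q i = 0" if "i \<notin> {..<length ds}"
      using assms q that by (auto simp: multi_indices_def dest: spec[of _ i])
  qed
  show "finite {q. \<forall>i. (i \<in> {..<length ds} \<longrightarrow> q i \<in> {..sum p {..<length ds}}) \<and>
      (i \<notin> {..<length ds} \<longrightarrow> q i = 0)}"
    by (rule finite_set_of_finite_funs) auto
qed

lemma monomial_size_mono: "(\<And>i. q i \<le> p i) \<Longrightarrow> monomial_size ds q \<le> monomial_size ds p"
  by (simp add: monomial_size_def sum_mono)

lemma monomial_size_less:
  assumes "p \<in> multi_indices ds" "\<And>i. q i \<le> p i" "q \<noteq> p"
  shows "monomial_size ds q < monomial_size ds p"
proof -
  obtain i where i: "q i \<noteq> p i"
    using \<open>q \<noteq> p\<close> by blast
  then have "q i < p i" "p i \<noteq> 0"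
    using assms(2)[of i] by auto
  moreover from this have "i < length ds"
    using assms(1) by (auto simp: multi_indices_def not_le[symmetric])
  ultimately show ?thesis
    unfolding monomial_size_def by (intro sum_strict_mono_ex1) (auto simp: assms(2))
qed

lemma monomial_degree_split:
  assumes "\<And>i. q i \<le> p i"
  shows "monomial_degree ds p = monomial_degree ds q + monomial_degree ds (\<lambda>i. p i - q i)"
proof -
  have "int (p i) * ds ! i = int (q i) * ds ! i + int (p i - q i) * ds ! i" for i
    using assms[of i] by (simp flip: distrib_right of_nat_add)
  then show ?thesis
    by (simp add: monomial_degree_def flip: sum.distrib)
qed

lemma monomial_sign_zero_left: "monomial_sign ds (\<lambda>_. 0) r = 1"
  by (simp add: monomial_sign_def)

lemma multi_indices_zero: "(\<lambda>_. 0) \<in> multi_indices ds"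
  by (simp add: multi_indices_def)

lemma series_mult_zero: "series_mult ds f g (\<lambda>_. 0) x = f (\<lambda>_. 0) x * g (\<lambda>_. 0) x"
proof -
  have "{q. \<forall>i. q i \<le> 0} = {\<lambda>_ :: nat. 0 :: nat}"
    by auto
  then show ?thesis
    by (simp add: series_mult_def multi_indices_zero monomial_sign_zero_left)
qed

text \<open>
  The inverse over \<open>W\<close> of a series \<open>f\<close> with nonzero constant term. The equation \<open>f g = 1\<close> is solved for
  the coefficient \<open>g\<^sub>p\<close> in terms of those of smaller total degree; outside \<open>W\<close> the coefficients are \<open>0\<close>,
  as required of series over \<open>W\<close>.
\<close>

function inverse_series :: "int list \<Rightarrow> (nat \<Rightarrow> real) set \<Rightarrow> power_series \<Rightarrow> power_series"
  where "inverse_series ds W f p x =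
    (if p \<in> multi_indices ds \<and> x \<in> W then
       (if p = (\<lambda>_. 0) then inverse (f (\<lambda>_. 0) x)
        else (- 1) * (inverse (f (\<lambda>_. 0) x) *
          (\<Sum>q\<in>{q. \<forall>i. q i \<le> p i} - {\<lambda>_. 0}.
             monomial_sign ds q (\<lambda>i. p i - q i) * f q x * inverse_series ds W f (\<lambda>i. p i - q i) x)))
     else 0)"
  by pat_completeness auto
termination
proof (relation "Wellfounded.measure (\<lambda>(ds, W, f, p, x). monomial_size ds p)")
  fix ds :: "int list" and W :: "(nat \<Rightarrow> real) set" and f :: power_series and p q x
  assume p: "p \<in> multi_indices ds \<and> x \<in> W" and q: "q \<in> {q. \<forall>i. q i \<le> p i} - {\<lambda>_. 0}"
  then obtain i where "q i \<noteq> 0"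
    by auto
  moreover have "q i \<le> p i"
    using q by simp
  ultimately have "(\<lambda>i. p i - q i) i \<noteq> p i"
    by simp
  then have "(\<lambda>i. p i - q i) \<noteq> p"
    by metis
  then have "monomial_size ds (\<lambda>i. p i - q i) < monomial_size ds p"
    using p by (intro monomial_size_less) auto
  then show "((ds, W, f, \<lambda>i. p i - q i, x), (ds, W, f, p, x))
      \<in> Wellfounded.measure (\<lambda>(ds, W, f, p, x). monomial_size ds p)"
    by simp
qed simp

declare inverse_series.simps [simp del]

lemma series_mult_inverse_series:
  assumes "\<And>x. x \<in> W \<Longrightarrow> f (\<lambda>_. 0) x \<noteq> 0" "\<And>p x. x \<notin> W \<Longrightarrow> f p x = 0"
  shows "series_mult ds f (inverse_series ds W f) =
    (\<lambda>p x. if p = (\<lambda>_. 0) \<and> x \<in> W then 1 else 0)"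
proof (intro ext)
  fix p :: "nat \<Rightarrow> nat" and x
  let ?g = "inverse_series ds W f"
  let ?S = "{q. \<forall>i. q i \<le> p i}"
  consider "p \<notin> multi_indices ds" | "x \<notin> W" | "p = (\<lambda>_. 0)" "x \<in> W"
    | "p \<in> multi_indices ds" "x \<in> W" "p \<noteq> (\<lambda>_. 0)"
    by blast
  then show "series_mult ds f ?g p x = (if p = (\<lambda>_. 0) \<and> x \<in> W then 1 else 0)"
  proof cases
    case 1
    then show ?thesis
      using multi_indices_zero by (auto simp: series_mult_def)
  next
    case 2
    then show ?thesis
      by (simp add: series_mult_def assms(2))
  next
    case 3
    then show ?thesis
      by (simp add: series_mult_zero inverse_series.simps[of ds W f "\<lambda>_. 0"] multi_indices_zero assms(1))
  next
    case 4
    let ?t = "\<lambda>q. monomial_sign ds q (\<lambda>i. p i - q i) * f q x * ?g (\<lambda>i. p i - q i) x"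
    have "series_mult ds f ?g p x = sum ?t ?S"
      using 4 by (simp add: series_mult_def)
    also have "\<dots> = ?t (\<lambda>_. 0) + sum ?t (?S - {\<lambda>_. 0})"
      using 4 by (intro sum.remove finite_multi_index_le) auto
    also have "?t (\<lambda>_. 0) = f (\<lambda>_. 0) x * ?g p x"
      by (simp add: monomial_sign_zero_left)
    also have "?g p x = - 1 * (inverse (f (\<lambda>_. 0) x) * sum ?t (?S - {\<lambda>_. 0}))"
      using 4 by (subst inverse_series.simps) simp
    finally show ?thesis
      using 4 assms(1) by simp
  qed
qed

lemma inverse_series_in_model_series:
  assumes W: "openin (Euclidean_space n) W" and f: "f \<in> model_series n ds W 0"
    and nz: "\<And>x. x \<in> W \<Longrightarrow> f (\<lambda>_. 0) x \<noteq> 0"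
  shows "inverse_series ds W f \<in> model_series n ds W 0"
proof -
  let ?g = "inverse_series ds W f"
  have smf: "smooth_fun_on n W (f p)" for p
    using f by (simp add: model_series_def)
  have "smooth_fun_on n W (?g p) \<and> (monomial_degree ds p \<noteq> 0 \<longrightarrow> (\<forall>x. ?g p x = 0))" for p
  proof (induction "monomial_size ds p" arbitrary: p rule: less_induct)
    case less
    let ?S = "{q. \<forall>i. q i \<le> p i} - {\<lambda>_. 0}"
    consider "p \<notin> multi_indices ds" | "p = (\<lambda>_. 0)" | "p \<in> multi_indices ds" "p \<noteq> (\<lambda>_. 0)"
      by blast
    then show ?case
    proof cases
      case 1
      then have "?g p = (\<lambda>_. 0)"
        by (auto simp: inverse_series.simps)
      then show ?thesis
        by (simp add: smooth_fun_on_def times_cont_diff_const W)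
    next
      case 2
      have "times_cont_diff n W k (?g p)" for k
      proof (rule times_cont_diff_cong[OF W times_cont_diff_inverse[OF W _ nz]])
        show "times_cont_diff n W k (f (\<lambda>_. 0))"
          using smf by (simp add: smooth_fun_on_def)
      qed (auto simp: 2 inverse_series.simps multi_indices_zero)
      then show ?thesis
        by (auto simp: smooth_fun_on_def 2 monomial_degree_def)
    next
      case 3
      have IH: "smooth_fun_on n W (?g (\<lambda>i. p i - q i))"
          "monomial_degree ds (\<lambda>i. p i - q i) \<noteq> 0 \<Longrightarrow> ?g (\<lambda>i. p i - q i) x = 0"
        if q: "q \<in> ?S" for q x
      proof -
        have "(\<lambda>i. p i - q i) \<noteq> p"
        proof
          assume eq: "(\<lambda>i. p i - q i) = p"
          have "q i = 0" for i
          proof -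
            have "q i \<le> p i"
              using q by simp
            then show ?thesis
              using fun_cong[OF eq, of i] by linarith
          qed
          then have "q = (\<lambda>_. 0)" ..
          with q show False
            by simp
        qed
        then have "monomial_size ds (\<lambda>i. p i - q i) < monomial_size ds p"
          using 3 by (intro monomial_size_less) auto
        from less[OF this] show "smooth_fun_on n W (?g (\<lambda>i. p i - q i))"
          "monomial_degree ds (\<lambda>i. p i - q i) \<noteq> 0 \<Longrightarrow> ?g (\<lambda>i. p i - q i) x = 0"
          by auto
      qed
      let ?t = "\<lambda>q x. monomial_sign ds q (\<lambda>i. p i - q i) * f q x * ?g (\<lambda>i. p i - q i) x"
      have g: "?g p x = - 1 * (inverse (f (\<lambda>_. 0) x) * (\<Sum>q\<in>?S. ?t q x))" if "x \<in> W" for x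
        using 3 that by (subst inverse_series.simps) simp
      have "times_cont_diff n W k (?g p)" for k
      proof (rule times_cont_diff_cong[OF W])
        have "smooth_fun_on n W (\<lambda>x. \<Sum>q\<in>?S. ?t q x)"
          using IH(1) smf
          by (intro smooth_fun_on_sum[OF W])
            (auto simp: smooth_fun_on_def intro!: times_cont_diff_mult times_cont_diff_const W)
        then show "times_cont_diff n W k (\<lambda>x. - 1 * (inverse (f (\<lambda>_. 0) x) * (\<Sum>q\<in>?S. ?t q x)))"
          using smf nz unfolding smooth_fun_on_def
          by (intro times_cont_diff_mult times_cont_diff_const times_cont_diff_inverse W) auto
      qed (simp add: g)
      moreover have "?g p x = 0" if "monomial_degree ds p \<noteq> 0" for x
      proof (cases "x \<in> W")
        case True
        have "?t q x = 0" if q: "q \<in> ?S" for q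
        proof -
          have "monomial_degree ds q \<noteq> 0 \<or> monomial_degree ds (\<lambda>i. p i - q i) \<noteq> 0"
            using monomial_degree_split[of q p ds] q \<open>monomial_degree ds p \<noteq> 0\<close> by auto
          then show ?thesis
            using IH(2)[OF q] f by (auto simp: model_series_def)
        qed
        then have "(\<Sum>q\<in>?S. ?t q x) = 0"
          by (intro sum.neutral ballI)
        then show ?thesis
          by (simp add: g[OF True])
      qed (simp add: inverse_series.simps)
      ultimately show ?thesis
        by (simp add: smooth_fun_on_def)
    qed
  qed
  moreover have "?g p x = 0" if "p \<notin> multi_indices ds \<or> x \<notin> W" for p x
    using that by (auto simp: inverse_series.simps[of ds W f p])
  ultimately show ?thesis
    unfolding model_series_def by blast
qed

section \<open>Linear algebra over the reals\<close>

lemma submodule_real_ringI: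
  assumes "Module.module real_ring V" "H \<subseteq> carrier V" "\<zero>\<^bsub>V\<^esub> \<in> H"
    and add: "\<And>a b. a \<in> H \<Longrightarrow> b \<in> H \<Longrightarrow> a \<oplus>\<^bsub>V\<^esub> b \<in> H"
    and smult: "\<And>r a. a \<in> H \<Longrightarrow> r \<odot>\<^bsub>V\<^esub> a \<in> H"
  shows "submodule H real_ring V"
proof -
  interpret Module.module real_ring V by fact
  show ?thesis
  proof (rule submoduleI)
    fix a assume a: "a \<in> H"
    have "\<ominus>\<^bsub>V\<^esub> a = (\<ominus>\<^bsub>real_ring\<^esub> \<one>\<^bsub>real_ring\<^esub>) \<odot>\<^bsub>V\<^esub> a"
      using a assms(2) smult_l_minus[of "\<one>\<^bsub>real_ring\<^esub>" a] by (auto simp: subset_iff)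
    then show "\<ominus>\<^bsub>V\<^esub> a \<in> H"
      using a smult by simp
  qed (use assms in auto)
qed

text \<open>
  The next lemmas restate the module axioms over \<open>real_ring\<close> with real numbers and their usual
  arithmetic in place of elements of the carrier and operations of a ring record.
\<close>

lemma module_real_ring_smult_zero:
  assumes "Module.module real_ring V" "x \<in> carrier V"
  shows "0 \<odot>\<^bsub>V\<^esub> x = \<zero>\<^bsub>V\<^esub>"
proof -
  interpret Module.module real_ring V by fact
  show ?thesis
    using smult_l_null[OF assms(2)] by (simp add: real_ring_def)
qed

lemma module_real_ring_smult_one:
  assumes "Module.module real_ring V" "x \<in> carrier V"
  shows "1 \<odot>\<^bsub>V\<^esub> x = x"
proof -
  interpret Module.module real_ring V by fact
  show ?thesis
    using smult_one[OF assms(2)] by (simp add: real_ring_def)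
qed

lemma module_real_ring_smult_closed:
  assumes "Module.module real_ring V" "x \<in> carrier V"
  shows "r \<odot>\<^bsub>V\<^esub> x \<in> carrier V"
proof -
  interpret Module.module real_ring V by fact
  show ?thesis
    using smult_closed[OF _ assms(2)] by (simp add: real_ring_def)
qed

lemma module_real_ring_smult_add:
  assumes "Module.module real_ring V" "x \<in> carrier V"
  shows "(r + s) \<odot>\<^bsub>V\<^esub> x = r \<odot>\<^bsub>V\<^esub> x \<oplus>\<^bsub>V\<^esub> s \<odot>\<^bsub>V\<^esub> x"
proof -
  interpret Module.module real_ring V by fact
  show ?thesis
    using smult_l_distr[of r s x] assms(2) by (simp add: real_ring_def)
qed

lemma module_real_ring_smult_smult:
  assumes "Module.module real_ring V" "x \<in> carrier V"
  shows "(r * s) \<odot>\<^bsub>V\<^esub> x = r \<odot>\<^bsub>V\<^esub> (s \<odot>\<^bsub>V\<^esub> x)"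
proof -
  interpret Module.module real_ring V by fact
  show ?thesis
    using smult_assoc1[of r s x] assms(2) by (simp add: real_ring_def)
qed

lemma module_real_ring_add_closed:
  assumes "Module.module real_ring V" "x \<in> carrier V" "y \<in> carrier V"
  shows "x \<oplus>\<^bsub>V\<^esub> y \<in> carrier V"
proof -
  interpret Module.module real_ring V by fact
  show ?thesis
    using assms by simp
qed

lemma module_real_ring_zero_closed:
  "Module.module real_ring V \<Longrightarrow> \<zero>\<^bsub>V\<^esub> \<in> carrier V"
  by (meson Module.module_def abelian_group_def abelian_monoid.zero_closed)

text \<open>Linear maps to the real numbers; nothing is required outside the carrier.\<close>

definition linear_functional :: "(real, 'a) module \<Rightarrow> ('a \<Rightarrow> real) \<Rightarrow> bool"
  where "linear_functional V h \<longleftrightarrow>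
    (\<forall>x\<in>carrier V. \<forall>y\<in>carrier V. h (x \<oplus>\<^bsub>V\<^esub> y) = h x + h y) \<and>
    (\<forall>r. \<forall>x\<in>carrier V. h (r \<odot>\<^bsub>V\<^esub> x) = r * h x)"

lemma linear_functional_zero:
  assumes "Module.module real_ring V" "linear_functional V h"
  shows "h \<zero>\<^bsub>V\<^esub> = 0"
proof -
  have "h (0 \<odot>\<^bsub>V\<^esub> \<zero>\<^bsub>V\<^esub>) = 0 * h \<zero>\<^bsub>V\<^esub>"
    using assms by (simp only: linear_functional_def module_real_ring_zero_closed)
  then show ?thesis
    by (simp add: assms(1) module_real_ring_smult_zero module_real_ring_zero_closed)
qed

text \<open>A minimal spanning set is a basis; its coordinate functions are the dual basis.\<close>

lemma finite_dim_dual_basis: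
  assumes V: "Module.module real_ring V"
    and ex: "\<exists>B. finite B \<and> B \<subseteq> carrier V \<and>
      (\<forall>x\<in>carrier V. \<exists>c. x = (\<Oplus>\<^bsub>V\<^esub>b\<in>B. c b \<odot>\<^bsub>V\<^esub> b))"
  obtains B co where "finite B" "B \<subseteq> carrier V"
    "\<And>x. x \<in> carrier V \<Longrightarrow> \<exists>c. x = (\<Oplus>\<^bsub>V\<^esub>b\<in>B. c b \<odot>\<^bsub>V\<^esub> b)"
    "\<And>b. b \<in> B \<Longrightarrow> linear_functional V (co b)"
    "\<And>b b'. b \<in> B \<Longrightarrow> b' \<in> B \<Longrightarrow> co b b' = (if b = b' then 1 else 0 :: real)"
proof -
  interpret Module.module real_ring V by fact
  note [simp] = module_real_ring_smult_closed[OF V]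
  let ?spans = "\<lambda>B. finite B \<and> B \<subseteq> carrier V \<and>
      (\<forall>x\<in>carrier V. \<exists>c. x = (\<Oplus>\<^bsub>V\<^esub>b\<in>B. c b \<odot>\<^bsub>V\<^esub> b))"
  obtain B\<^sub>0 where "?spans B\<^sub>0"
    using ex by blast
  then obtain B where B: "?spans B" and min: "\<And>B'. ?spans B' \<Longrightarrow> card B \<le> card B'"
    using ex_has_least_nat[where P = ?spans and m = card, of B\<^sub>0] by auto
  have finB: "finite B" and BV: "\<And>b. b \<in> B \<Longrightarrow> b \<in> carrier V"
    using B by auto
  define comb where "comb c = (\<Oplus>\<^bsub>V\<^esub>b\<in>B. c b \<odot>\<^bsub>V\<^esub> b)" for c
  have comb_closed: "comb c \<in> carrier V" for c
    unfolding comb_def by (rule finsum_closed) (auto simp: BV)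
  have comb_add: "comb (\<lambda>b. c b + d b) = comb c \<oplus>\<^bsub>V\<^esub> comb d" for c d
  proof -
    have "comb (\<lambda>b. c b + d b) = (\<Oplus>\<^bsub>V\<^esub>b\<in>B. c b \<odot>\<^bsub>V\<^esub> b \<oplus>\<^bsub>V\<^esub> d b \<odot>\<^bsub>V\<^esub> b)"
      unfolding comb_def by (intro finsum_cong') (auto simp: BV module_real_ring_smult_add[OF V])
    also have "\<dots> = comb c \<oplus>\<^bsub>V\<^esub> comb d"
      unfolding comb_def by (rule finsum_addf) (auto simp: BV)
    finally show ?thesis .
  qed
  have comb_smult: "comb (\<lambda>b. r * c b) = r \<odot>\<^bsub>V\<^esub> comb c" for r c
  proof -
    have "comb (\<lambda>b. r * c b) = (\<Oplus>\<^bsub>V\<^esub>b\<in>B. r \<odot>\<^bsub>V\<^esub> (c b \<odot>\<^bsub>V\<^esub> b))"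
      unfolding comb_def by (intro finsum_cong') (auto simp: BV module_real_ring_smult_smult[OF V])
    also have "\<dots> = r \<odot>\<^bsub>V\<^esub> comb c"
      unfolding comb_def
      by (rule finsum_smult_ldistr[symmetric]) (auto simp: BV finB real_ring_def)
    finally show ?thesis .
  qed
  have comb_cong: "comb c = comb d" if "\<And>b. b \<in> B \<Longrightarrow> c b = d b" for c d
    unfolding comb_def by (intro finsum_cong') (auto simp: BV that)
  have comb_zero: "comb (\<lambda>_. 0) = \<zero>\<^bsub>V\<^esub>"
    using comb_smult[of 0 "\<lambda>_. 0"] module_real_ring_smult_zero[OF V comb_closed] by simp
  have comb_single: "comb (\<lambda>b'. if b' = b then 1 else 0) = b" if "b \<in> B" for b
  proof -
    have "comb (\<lambda>b'. if b' = b then 1 else 0) = (\<Oplus>\<^bsub>V\<^esub>b'\<in>B. if b = b' then b' else \<zero>\<^bsub>V\<^esub>)"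
      unfolding comb_def
      by (intro finsum_cong')
        (auto simp: BV module_real_ring_smult_zero[OF V] module_real_ring_smult_one[OF V])
    also have "\<dots> = b"
      using that finB BV by (intro finsum_singleton) auto
    finally show ?thesis .
  qed
  have indep: "c b = 0" if "comb c = \<zero>\<^bsub>V\<^esub>" "b \<in> B" for c b
  proof (rule ccontr)
    assume nz: "c b \<noteq> 0"
    have "?spans (B - {b})"
    proof (intro conjI ballI)
      fix x assume "x \<in> carrier V"
      then obtain d where d: "x = comb d"
        using B unfolding comb_def by blast
      \<comment> \<open>Subtracting a multiple of the relation \<open>c\<close> removes \<open>b\<close> from the combination \<open>d\<close>.\<close>
      define e where "e b' = d b' + (- d b / c b) * c b'" for b'
      have "e b = 0"
        using nz by (simp add: e_def)
      have "comb e = x"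
        unfolding e_def comb_add comb_smult that(1)
        using d comb_closed by (simp add: smult_r_null[of "- d b / c b"] real_ring_def)
      then have "x = (\<Oplus>\<^bsub>V\<^esub>b'\<in>insert b (B - {b}). e b' \<odot>\<^bsub>V\<^esub> b')"
        using \<open>b \<in> B\<close> by (simp add: comb_def insert_absorb)
      also have "\<dots> = e b \<odot>\<^bsub>V\<^esub> b \<oplus>\<^bsub>V\<^esub> (\<Oplus>\<^bsub>V\<^esub>b'\<in>B - {b}. e b' \<odot>\<^bsub>V\<^esub> b')"
        using finB by (intro finsum_insert) (auto simp: BV \<open>b \<in> B\<close>)
      also have "\<dots> = (\<Oplus>\<^bsub>V\<^esub>b'\<in>B - {b}. e b' \<odot>\<^bsub>V\<^esub> b')"
        using \<open>e b = 0\<close> \<open>b \<in> B\<close>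
        by (simp add: BV module_real_ring_smult_zero[OF V] finsum_closed Pi_def)
      finally show "\<exists>e. x = (\<Oplus>\<^bsub>V\<^esub>b'\<in>B - {b}. e b' \<odot>\<^bsub>V\<^esub> b')"
        by blast
    qed (use B in auto)
    then have "card B \<le> card (B - {b})"
      by (rule min)
    then show False
      using \<open>b \<in> B\<close> finB by (metis card_Diff1_less linorder_not_le)
  qed
  have uniq: "c b = d b" if "comb c = comb d" "b \<in> B" for c d b
  proof -
    have "comb (\<lambda>b. c b + - 1 * d b) = comb (\<lambda>b. d b + - 1 * d b)"
      unfolding comb_add comb_smult that(1) by simp
    also have "\<dots> = \<zero>\<^bsub>V\<^esub>"
      by (simp add: comb_zero)
    finally show ?thesis
      using indep[of "\<lambda>b. c b + - 1 * d b" b] that(2) by simp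
  qed
  define cf where "cf x = (SOME c. comb c = x)" for x
  have cf: "comb (cf x) = x" if x: "x \<in> carrier V" for x
  proof -
    obtain c where "x = comb c"
      using B x unfolding comb_def by blast
    then show ?thesis
      unfolding cf_def by (intro someI[of "\<lambda>c. comb c = x"]) simp
  qed
  show ?thesis
  proof (rule that[of B "\<lambda>b x. cf x b"])
    fix b assume b: "b \<in> B"
    show "linear_functional V (\<lambda>x. cf x b)"
      unfolding linear_functional_def
    proof (intro conjI ballI allI)
      fix x y assume "x \<in> carrier V" "y \<in> carrier V"
      then show "cf (x \<oplus>\<^bsub>V\<^esub> y) b = cf x b + cf y b"
        by (intro uniq[of _ "\<lambda>b. cf x b + cf y b", OF _ b]) (simp add: comb_add cf)
    next
      fix r x assume "x \<in> carrier V"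
      then show "cf (r \<odot>\<^bsub>V\<^esub> x) b = r * cf x b"
        by (intro uniq[of _ "\<lambda>b. r * cf x b", OF _ b]) (simp add: comb_smult cf)
    qed
    fix b' assume "b' \<in> B"
    then have "cf b' b = (if b = b' then 1 else 0)"
      by (intro uniq[of _ "\<lambda>b. if b = b' then 1 else 0", OF _ b]) (simp add: comb_single cf BV)
    then show "cf b' b = (if b = b' then 1 else 0 :: real)" .
  qed (use B in auto)
qed

section \<open>Tensors over the reals\<close>

lemma tensor_eq_elementary:
  assumes "\<And>i. Module.module real_ring (A i)" "\<And>d. Module.module real_ring (K d)"
    and "tensor_eq A K j x y"
  shows "set_mset x \<subseteq> elementary_tensors A K j \<and> set_mset y \<subseteq> elementary_tensors A K j"
  using assms(3)
  by induction
    (use assms(1,2) in \<open>auto simp: elementary_tensors_def module_real_ring_add_closed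
        module_real_ring_smult_closed module_real_ring_zero_closed\<close>)

lemma tensor_eq_plus_left:
  assumes "tensor_eq A K j x y" "set_mset z \<subseteq> elementary_tensors A K j"
  shows "tensor_eq A K j (z + x) (z + y)"
  using assms(2) by (induction z) (auto simp: assms(1) intro: tensor_eq.cong)

lemma tensor_eq_plus:
  assumes "\<And>i. Module.module real_ring (A i)" "\<And>d. Module.module real_ring (K d)"
    and "tensor_eq A K j x x'" "tensor_eq A K j y y'"
  shows "tensor_eq A K j (x + y) (x' + y')"
proof (rule tensor_eq.trans)
  show "tensor_eq A K j (x + y) (x + y')"
    using assms tensor_eq_elementary by (intro tensor_eq_plus_left) blast+
  have "tensor_eq A K j (y' + x) (y' + x')"
    using assms tensor_eq_elementary by (intro tensor_eq_plus_left) blast+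
  then show "tensor_eq A K j (x + y') (x' + y')"
    by (simp add: add.commute)
qed

text \<open>
  Contraction of a tensor in \<open>A \<otimes> K\<close> with a functional \<open>l\<close> on the summand of \<open>K\<close> complementary to
  degree \<open>i\<close>, followed by a functional \<open>e\<close> on \<open>A\<close> in degree \<open>i\<close>; it is given on representatives.
\<close>

definition tensor_eval ::
    "int \<Rightarrow> ('k \<Rightarrow> real) \<Rightarrow> ('a \<Rightarrow> real) \<Rightarrow> ('a, 'k) formal_tensor \<Rightarrow> real"
  where "tensor_eval i l e x = (\<Sum>(i', f, k)\<in>#x. if i' = i then e f * l k else 0)"

lemma tensor_eval_empty [simp]: "tensor_eval i l e {#} = 0"
  by (simp add: tensor_eval_def)

lemma tensor_eval_add_mset [simp]:
  "tensor_eval i l e (add_mset (i', f, k) x) =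
    (if i' = i then e f * l k else 0) + tensor_eval i l e x"
  by (simp add: tensor_eval_def)

lemma tensor_eval_plus: "tensor_eval i l e (x + y) = tensor_eval i l e x + tensor_eval i l e y"
  by (simp add: tensor_eval_def)

lemma tensor_eval_cong:
  assumes "tensor_eq A K j x y" "Module.module real_ring (A i)"
    and e: "linear_functional (A i) e" and l: "linear_functional (K (j - i)) l"
  shows "tensor_eval i l e x = tensor_eval i l e y"
  using assms(1)
proof induction
  case (cong x y t)
  then show ?case
    by (cases t) simp
next
  case (zero k i')
  then show ?case
    using linear_functional_zero[OF assms(2) e] by simp
qed (use e l in \<open>auto simp: linear_functional_def algebra_simps\<close>)

lemma tensor_eq_zero_right:
  assumes "\<And>i. Module.module real_ring (A i)" "\<And>d. Module.module real_ring (K d)"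
    and "f \<in> carrier (A i)"
  shows "tensor_eq A K j {#(i, f, \<zero>\<^bsub>K (j - i)\<^esub>)#} {#}"
proof -
  have z: "\<zero>\<^bsub>K (j - i)\<^esub> \<in> carrier (K (j - i))"
    using assms(2) by (rule module_real_ring_zero_closed)
  have "tensor_eq A K j {#(i, f, 0 \<odot>\<^bsub>K (j - i)\<^esub> \<zero>\<^bsub>K (j - i)\<^esub>)#} {#(i, 0 \<odot>\<^bsub>A i\<^esub> f, \<zero>\<^bsub>K (j - i)\<^esub>)#}"
    using assms z by (intro tensor_eq.sym[OF tensor_eq.balanced])
  then show ?thesis
    using tensor_eq.zero[of "\<zero>\<^bsub>K (j - i)\<^esub>" K j i A] assms z
    by (auto simp: module_real_ring_smult_zero intro: tensor_eq.trans)
qed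

lemma tensor_eq_spanning:
  assumes A: "\<And>i. Module.module real_ring (A i)" and K: "\<And>d. Module.module real_ring (K d)"
    and B: "\<And>d. finite (B d)" "\<And>d. B d \<subseteq> carrier (K d)"
    and span: "\<And>d x. x \<in> carrier (K d) \<Longrightarrow> \<exists>c. x = (\<Oplus>\<^bsub>K d\<^esub>b\<in>B d. c b \<odot>\<^bsub>K d\<^esub> b)"
    and x: "set_mset x \<subseteq> elementary_tensors A K j"
  shows "\<exists>y. tensor_eq A K j x y \<and> (\<forall>(i, f, b)\<in>#y. f \<in> carrier (A i) \<and> b \<in> B (j - i))"
  using x
proof (induction x)
  case empty
  then show ?case
    by (intro exI[of _ "{#}"]) (simp add: tensor_eq.refl)
next
  case (add t x)
  obtain i f k where t: "t = (i, f, k)"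
    by (cases t)
  then have f: "f \<in> carrier (A i)" and k: "k \<in> carrier (K (j - i))"
    using add.prems by (auto simp: elementary_tensors_def)
  interpret Module.module real_ring "K (j - i)"
    by (rule K)
  obtain c where c: "k = (\<Oplus>\<^bsub>K (j - i)\<^esub>b\<in>B (j - i). c b \<odot>\<^bsub>K (j - i)\<^esub> b)"
    using span[OF k] by blast
  have BK: "c b \<odot>\<^bsub>K (j - i)\<^esub> b \<in> carrier (K (j - i))" if "b \<in> B (j - i)" for b
    using B(2) that by (intro module_real_ring_smult_closed K) auto
  have "\<exists>y. tensor_eq A K j {#(i, f, \<Oplus>\<^bsub>K (j - i)\<^esub>b\<in>S. c b \<odot>\<^bsub>K (j - i)\<^esub> b)#} y \<and>
      (\<forall>(i, f, b)\<in>#y. f \<in> carrier (A i) \<and> b \<in> B (j - i))"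
    if S: "finite S" "S \<subseteq> B (j - i)" for S
    using S
  proof (induction S)
    case empty
    show ?case
      using tensor_eq_zero_right[of A K f i j] A K f by (intro exI[of _ "{#}"]) simp
  next
    case (insert b S)
    then obtain y where
      y: "tensor_eq A K j {#(i, f, \<Oplus>\<^bsub>K (j - i)\<^esub>b\<in>S. c b \<odot>\<^bsub>K (j - i)\<^esub> b)#} y"
        "\<forall>(i, f, b)\<in>#y. f \<in> carrier (A i) \<and> b \<in> B (j - i)"
      by auto
    have b: "b \<in> B (j - i)" "b \<in> carrier (K (j - i))"
      using insert.prems B(2) by auto
    have S: "(\<Oplus>\<^bsub>K (j - i)\<^esub>b\<in>S. c b \<odot>\<^bsub>K (j - i)\<^esub> b) \<in> carrier (K (j - i))"
      using BK insert.prems by (intro finsum_closed) auto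
    have "(\<Oplus>\<^bsub>K (j - i)\<^esub>b\<in>insert b S. c b \<odot>\<^bsub>K (j - i)\<^esub> b) =
        c b \<odot>\<^bsub>K (j - i)\<^esub> b \<oplus>\<^bsub>K (j - i)\<^esub> (\<Oplus>\<^bsub>K (j - i)\<^esub>b\<in>S. c b \<odot>\<^bsub>K (j - i)\<^esub> b)"
      using BK insert.hyps insert.prems by (intro finsum_insert) auto
    then have "tensor_eq A K j {#(i, f, \<Oplus>\<^bsub>K (j - i)\<^esub>b\<in>insert b S. c b \<odot>\<^bsub>K (j - i)\<^esub> b)#}
        ({#(i, f, c b \<odot>\<^bsub>K (j - i)\<^esub> b)#} + {#(i, f, \<Oplus>\<^bsub>K (j - i)\<^esub>b\<in>S. c b \<odot>\<^bsub>K (j - i)\<^esub> b)#})"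
      using tensor_eq.add_right[of f A i "c b \<odot>\<^bsub>K (j - i)\<^esub> b" K j, OF f BK[OF b(1)] S]
      by (simp add: add_mset_commute)
    moreover have "tensor_eq A K j
        ({#(i, f, c b \<odot>\<^bsub>K (j - i)\<^esub> b)#} + {#(i, f, \<Oplus>\<^bsub>K (j - i)\<^esub>b\<in>S. c b \<odot>\<^bsub>K (j - i)\<^esub> b)#})
        ({#(i, c b \<odot>\<^bsub>A i\<^esub> f, b)#} + y)"
      using f b y(1)
      by (intro tensor_eq_plus[OF A K]) (auto intro: tensor_eq.sym[OF tensor_eq.balanced])
    ultimately have "tensor_eq A K j {#(i, f, \<Oplus>\<^bsub>K (j - i)\<^esub>b\<in>insert b S. c b \<odot>\<^bsub>K (j - i)\<^esub> b)#}
        (add_mset (i, c b \<odot>\<^bsub>A i\<^esub> f, b) y)"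
      using tensor_eq.trans by fastforce
    then show ?case
      using y(2) b(1) f A 
      by (intro exI[of _ "add_mset (i, c b \<odot>\<^bsub>A i\<^esub> f, b) y"])
        (auto simp: module_real_ring_smult_closed)
  qed
  from this[OF B(1) order.refl] obtain y where
    y: "tensor_eq A K j {#t#} y" "\<forall>(i, f, b)\<in>#y. f \<in> carrier (A i) \<and> b \<in> B (j - i)"
    unfolding t c by blast
  obtain z where
    z: "tensor_eq A K j x z" "\<forall>(i, f, b)\<in>#z. f \<in> carrier (A i) \<and> b \<in> B (j - i)"
    using add by auto
  have "tensor_eq A K j (add_mset t x) (y + z)"
    using tensor_eq_plus[OF A K y(1) z(1)] by simp
  then show ?case
    using y(2) z(2) by (intro exI[of _ "y + z"]) auto
qed

text \<open>
  Functionals detect the zero tensor. A representative of minimal length over a basis of \<open>K\<close> cannot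
  contain the same basis vector twice in the same degree, so contracting with the dual basis reads
  off its left factors.
\<close>

lemma tensor_eq_emptyI:
  fixes K :: "int \<Rightarrow> (real, 'k) module"
  assumes A: "\<And>i. Module.module real_ring (A i)" and K: "finite_dim_graded K"
    and Ev: "\<And>i e. e \<in> Ev i \<Longrightarrow> linear_functional (A i) e"
    and sep: "\<And>i f. f \<in> carrier (A i) \<Longrightarrow> (\<And>e. e \<in> Ev i \<Longrightarrow> e f = 0) \<Longrightarrow> f = \<zero>\<^bsub>A i\<^esub>"
    and x: "set_mset x \<subseteq> elementary_tensors A K j"
    and zero: "\<And>i l e. linear_functional (K (j - i)) l \<Longrightarrow> e \<in> Ev i \<Longrightarrow> tensor_eval i l e x = 0"
  shows "tensor_eq A K j x {#}"
proof -
  have KV: "Module.module real_ring (K d)" for d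
    using K by (simp add: finite_dim_graded_def)
  define Q :: "int \<Rightarrow> 'k set \<Rightarrow> ('k \<Rightarrow> 'k \<Rightarrow> real) \<Rightarrow> bool" where
    "Q d B co \<longleftrightarrow> finite B \<and> B \<subseteq> carrier (K d) \<and>
      (\<forall>x\<in>carrier (K d). \<exists>c. x = (\<Oplus>\<^bsub>K d\<^esub>b\<in>B. c b \<odot>\<^bsub>K d\<^esub> b)) \<and>
      (\<forall>b\<in>B. linear_functional (K d) (co b)) \<and>
      (\<forall>b\<in>B. \<forall>b'\<in>B. co b b' = (if b = b' then 1 else 0))" for d B co
  have ex: "\<exists>B co. Q d B co" for d
  proof -
    have ex: "\<exists>B. finite B \<and> B \<subseteq> carrier (K d) \<and>
        (\<forall>x\<in>carrier (K d). \<exists>c. x = (\<Oplus>\<^bsub>K d\<^esub>b\<in>B. c b \<odot>\<^bsub>K d\<^esub> b))"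
      using K by (simp add: finite_dim_graded_def)
    show ?thesis
    proof (rule finite_dim_dual_basis[OF KV ex])
      fix B and co :: "'k \<Rightarrow> 'k \<Rightarrow> real"
      assume "finite B" "B \<subseteq> carrier (K d)"
        "\<And>x. x \<in> carrier (K d) \<Longrightarrow> \<exists>c. x = (\<Oplus>\<^bsub>K d\<^esub>b\<in>B. c b \<odot>\<^bsub>K d\<^esub> b)"
        "\<And>b. b \<in> B \<Longrightarrow> linear_functional (K d) (co b)"
        "\<And>b b'. b \<in> B \<Longrightarrow> b' \<in> B \<Longrightarrow> co b b' = (if b = b' then 1 else 0)"
      then have "Q d B co"
        unfolding Q_def by blast
      then show ?thesis
        by blast
    qed
  qed
  define B where "B d = (SOME B. \<exists>co. Q d B co)" for d
  define co where "co d = (SOME co. Q d (B d) co)" for d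
  have Q: "Q d (B d) (co d)" for d
    unfolding co_def B_def by (intro someI_ex[of "Q d (SOME B. \<exists>co. Q d B co)"]
        someI_ex[of "\<lambda>B. \<exists>co. Q d B co"] ex)
  then have B: "\<And>d. finite (B d)" "\<And>d. B d \<subseteq> carrier (K d)"
    and span: "\<And>d x. x \<in> carrier (K d) \<Longrightarrow> \<exists>c. x = (\<Oplus>\<^bsub>K d\<^esub>b\<in>B d. c b \<odot>\<^bsub>K d\<^esub> b)"
    and co: "\<And>d b. b \<in> B d \<Longrightarrow> linear_functional (K d) (co d b)"
    and dual: "\<And>d b b'. b \<in> B d \<Longrightarrow> b' \<in> B d \<Longrightarrow> co d b b' = (if b = b' then 1 else 0)"
    unfolding Q_def by blast+
  let ?repr = "\<lambda>y. tensor_eq A K j x y \<and> (\<forall>(i, f, b)\<in>#y. f \<in> carrier (A i) \<and> b \<in> B (j - i))"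
  obtain y\<^sub>0 where "?repr y\<^sub>0"
    using tensor_eq_spanning[OF A KV B span x] by blast
  then obtain y where y: "?repr y" and min: "\<And>y'. ?repr y' \<Longrightarrow> size y \<le> size y'"
    using ex_has_least_nat[where P = ?repr and m = size, of y\<^sub>0] by auto
  have el: "set_mset z \<subseteq> elementary_tensors A K j"
    if "\<forall>(i, f, b)\<in>#z. f \<in> carrier (A i) \<and> b \<in> B (j - i)" for z
    using that B(2) by (fastforce simp: elementary_tensors_def)
  have "y = {#}"
  proof (rule ccontr)
    assume "y \<noteq> {#}"
    then obtain t z where yz: "y = add_mset t z"
      using multiset_cases by blast
    obtain i f b where t: "t = (i, f, b)"
      by (cases t)
    have f: "f \<in> carrier (A i)" and b: "b \<in> B (j - i)" and bK: "b \<in> carrier (K (j - i))"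
      and z: "\<forall>(i, f, b)\<in>#z. f \<in> carrier (A i) \<and> b \<in> B (j - i)"
      using y B(2) by (auto simp: yz t)
    have distinct: "(i, g, b) \<notin># z" for g
    proof
      assume "(i, g, b) \<in># z"
      then obtain w where w: "z = add_mset (i, g, b) w"
        by (meson mset_add)
      then have g: "g \<in> carrier (A i)"
        and w': "\<forall>(i, f, b)\<in>#w. f \<in> carrier (A i) \<and> b \<in> B (j - i)"
        using z by auto
      have "tensor_eq A K j ({#(i, f, b), (i, g, b)#} + w) ({#(i, f \<oplus>\<^bsub>A i\<^esub> g, b)#} + w)"
        using f g bK w' el
        by (intro tensor_eq_plus[OF A KV] tensor_eq.sym[OF tensor_eq.add_left] tensor_eq.refl) auto
      then have "tensor_eq A K j x (add_mset (i, f \<oplus>\<^bsub>A i\<^esub> g, b) w)"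
        using y unfolding yz t w by (auto intro: tensor_eq.trans)
      then have "?repr (add_mset (i, f \<oplus>\<^bsub>A i\<^esub> g, b) w)"
        using f g b w' A by (auto simp: module_real_ring_add_closed)
      from min[OF this] show False
        by (simp add: yz w)
    qed
    have "e f = 0" if e: "e \<in> Ev i" for e
    proof -
      let ?l = "co (j - i) b"
      have "(case s of (i', f, k) \<Rightarrow> if i' = i then e f * ?l k else 0) = 0" if s: "s \<in># z" for s
      proof -
        obtain i' g b' where s': "s = (i', g, b')"
          by (cases s)
        then have "i' = i \<Longrightarrow> b' \<in> B (j - i) \<and> b' \<noteq> b"
          using z distinct s by auto
        then show ?thesis
          by (cases "i' = i") (auto simp: dual[OF b] s')
      qed
      then have "tensor_eval i ?l e z = 0"
        unfolding tensor_eval_def by (intro sum_mset.neutral) auto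
      moreover have "tensor_eval i ?l e y = 0"
        using zero[OF co[OF b] e] tensor_eval_cong[of A K j x y i e ?l] y A Ev[OF e] co[OF b] by simp
      ultimately show ?thesis
        using dual[OF b b] by (simp add: yz t)
    qed
    then have f0: "f = \<zero>\<^bsub>A i\<^esub>"
      using sep f by blast
    have "tensor_eq A K j ({#t#} + z) ({#} + z)"
      unfolding t f0 using bK z el
      by (intro tensor_eq_plus[OF A KV] tensor_eq.zero tensor_eq.refl) auto
    then have "?repr z"
      using y z by (auto simp: yz intro: tensor_eq.trans)
    from min[OF this] show False
      by (simp add: yz)
  qed
  then show ?thesis
    using y by simp
qed

section \<open>Charts and the body\<close>

lemma series_mult_eq_zero_right:
  assumes "\<And>r. monomial_size ds r < q \<Longrightarrow> g r x = 0" "monomial_size ds p < q"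
  shows "series_mult ds f g p x = 0"
proof -
  have "g (\<lambda>i. p i - s i) x = 0" for s :: "nat \<Rightarrow> nat"
  proof (rule assms(1))
    have "monomial_size ds (\<lambda>i. p i - s i) \<le> monomial_size ds p"
      by (rule monomial_size_mono) simp
    then show "monomial_size ds (\<lambda>i. p i - s i) < q"
      using assms(2) by simp
  qed
  then show ?thesis
    by (simp add: series_mult_def)
qed

text \<open>
  Multiplying by a series without constant term at \<open>x\<close> raises the vanishing order in the graded
  variables at \<open>x\<close> by one: in total degree \<open>q\<close> the only surviving term contains that constant term.
\<close>

lemma series_mult_eq_zero_Suc:
  assumes "\<And>r. monomial_size ds r < q \<Longrightarrow> f r x = 0" "g (\<lambda>_. 0) x = 0"
    and "monomial_size ds p < Suc q"
  shows "series_mult ds f g p x = 0"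
proof (cases "p \<in> multi_indices ds")
  case True
  have "f s x * g (\<lambda>i. p i - s i) x = 0" if s: "\<forall>i. s i \<le> p i" for s
  proof (cases "s = p")
    case False
    then have "monomial_size ds s < q"
      using monomial_size_less[OF True, of s] s assms(3) by auto
    then show ?thesis
      by (simp add: assms(1))
  qed (simp add: assms(2))
  then show ?thesis
    by (auto simp: series_mult_def mult.assoc intro!: sum.neutral)
qed (simp add: series_mult_def)

lemma graded_chart_subset:
  assumes c: "graded_chart M \<O> n ds V \<phi> \<Phi>" and W: "openin M W" "W \<subseteq> V"
  shows "graded_chart M \<O> n ds W \<phi> \<Phi>"
proof -
  have V: "openin M V" "openin (Euclidean_space n) (\<phi> ` V)"
    and h: "homeomorphic_map (subtopology M V) (subtopology (Euclidean_space n) (\<phi> ` V)) \<phi>"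
    and iso: "galgebra_sheaf_iso M V \<phi> \<O> (model_sheaf n ds) \<Phi>"
    using c by (auto simp: graded_chart_def)
  have "openin (subtopology M V) W"
    using V(1) W by (simp add: openin_open_subtopology)
  then have "openin (subtopology (Euclidean_space n) (\<phi> ` V)) (\<phi> ` W)"
    using homeomorphic_map_openness_eq[OF h] by blast
  then have 1: "openin (Euclidean_space n) (\<phi> ` W)"
    using V(2) by (simp add: openin_open_subtopology)
  have "W \<subseteq> topspace M" "\<phi> ` W \<subseteq> topspace (Euclidean_space n)"
    using W(1) 1 by (auto dest: openin_subset)
  then have "\<phi> ` (topspace (subtopology M V) \<inter> W) =
      topspace (subtopology (Euclidean_space n) (\<phi> ` V)) \<inter> \<phi> ` W"
    using W(2) by auto
  from homeomorphic_map_subtopologies[OF h this]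
  have 2: "homeomorphic_map (subtopology M W) (subtopology (Euclidean_space n) (\<phi> ` W)) \<phi>"
    using W(2) by (simp add: subtopology_subtopology Int_absorb1 image_mono)
  have 3: "galgebra_sheaf_iso M W \<phi> \<O> (model_sheaf n ds) \<Phi>"
    using iso W(2) unfolding galgebra_sheaf_iso_def gsheaf_iso_def by (meson subset_trans)
  show ?thesis
    using W(1) 1 2 3 by (simp add: graded_chart_def)
qed

lemma graded_chart_open:
  "graded_chart M \<O> n ds V \<phi> \<Phi> \<Longrightarrow> openin M V"
  "graded_chart M \<O> n ds V \<phi> \<Phi> \<Longrightarrow> openin (Euclidean_space n) (\<phi> ` V)"
  by (auto simp: graded_chart_def)

lemma graded_chart_linear:
  assumes "graded_chart M \<O> n ds V \<phi> \<Phi>"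
  shows "linear_map (sec \<O> V j) (sec (model_sheaf n ds) (\<phi> ` V) j) (\<Phi> V j)"
    and "bij_betw (\<Phi> V j) (carrier (sec \<O> V j)) (model_series n ds (\<phi> ` V) j)"
  using assms by (simp_all add: graded_chart_def galgebra_sheaf_iso_def gsheaf_iso_def model_sheaf_def)

lemma graded_chart_in_model_series:
  assumes "graded_chart M \<O> n ds V \<phi> \<Phi>" "f \<in> carrier (sec \<O> V j)"
  shows "\<Phi> V j f \<in> model_series n ds (\<phi> ` V) j"
  using graded_chart_linear(2)[OF assms(1)] assms(2) by (auto simp: bij_betw_def)

lemma graded_chart_add:
  assumes "graded_chart M \<O> n ds V \<phi> \<Phi>" "f \<in> carrier (sec \<O> V j)" "g \<in> carrier (sec \<O> V j)"
  shows "\<Phi> V j (f \<oplus>\<^bsub>sec \<O> V j\<^esub> g) p x = \<Phi> V j f p x + \<Phi> V j g p x"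
  using graded_chart_linear(1)[OF assms(1), of j] assms(2,3)
  by (simp add: linear_map_def model_sheaf_def)

lemma graded_chart_smult:
  assumes "graded_chart M \<O> n ds V \<phi> \<Phi>" "f \<in> carrier (sec \<O> V j)"
  shows "\<Phi> V j (r \<odot>\<^bsub>sec \<O> V j\<^esub> f) p x = r * \<Phi> V j f p x"
  using graded_chart_linear(1)[OF assms(1), of j] assms(2)
  by (simp add: linear_map_def model_sheaf_def)

lemma graded_chart_functional:
  assumes "graded_chart M \<O> n ds V \<phi> \<Phi>"
  shows "linear_functional (sec \<O> V j) (\<lambda>f. \<Phi> V j f p x)"
  using assms by (simp add: linear_functional_def graded_chart_add graded_chart_smult)

lemma graded_chart_res:
  assumes "graded_chart M \<O> n ds V \<phi> \<Phi>" "openin M W" "W \<subseteq> V" "f \<in> carrier (sec \<O> V j)"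
  shows "\<Phi> W j (res \<O> V W j f) p x = (if x \<in> \<phi> ` W then \<Phi> V j f p x else 0)"
  using assms by (simp add: graded_chart_def galgebra_sheaf_iso_def gsheaf_iso_def model_sheaf_def)

lemma graded_chart_mul:
  assumes "graded_chart M \<O> n ds V \<phi> \<Phi>" "f \<in> carrier (sec \<O> V i)" "g \<in> carrier (sec \<O> V j)"
  shows "\<Phi> V (i + j) (mul \<O> V i j f g) = series_mult ds (\<Phi> V i f) (\<Phi> V j g)"
  using assms by (simp add: graded_chart_def galgebra_sheaf_iso_def model_sheaf_def)

lemma graded_chart_unit:
  assumes "graded_chart M \<O> n ds V \<phi> \<Phi>"
  shows "\<Phi> V 0 (unit \<O> V) = (\<lambda>p x. if p = (\<lambda>_. 0) \<and> x \<in> \<phi> ` V then 1 else 0)"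
  using assms by (simp add: graded_chart_def galgebra_sheaf_iso_def model_sheaf_def)

context sheaf_of_graded_algebras
begin

lemma mul_closed:
  assumes "openin M U" "f \<in> carrier (sec \<O> U i)" "g \<in> carrier (sec \<O> U j)"
  shows "mul \<O> U i j f g \<in> carrier (sec \<O> U (i + j))"
proof -
  interpret graded_comm_algebra "sec \<O> U" "mul \<O> U" "unit \<O> U"
    using assms(1) by (rule sec_algebra)
  show ?thesis
    using mult_linear_right[OF assms(2), of j] assms(3) by (auto simp: linear_map_def)
qed

lemma unit_in_sec: "openin M U \<Longrightarrow> unit \<O> U \<in> carrier (sec \<O> U 0)"
  by (rule graded_comm_algebra.unit_closed[OF sec_algebra])

lemma chart_invertible:
  assumes c: "graded_chart M \<O> n ds V \<phi> \<Phi>" and f: "f \<in> carrier (sec \<O> V 0)"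
    and nz: "\<And>z. z \<in> V \<Longrightarrow> \<Phi> V 0 f (\<lambda>_. 0) (\<phi> z) \<noteq> 0"
  shows "\<exists>g\<in>carrier (sec \<O> V 0). mul \<O> V 0 0 f g = unit \<O> V"
proof -
  note V = graded_chart_open[OF c]
  have F: "\<Phi> V 0 f \<in> model_series n ds (\<phi> ` V) 0"
    using c f by (rule graded_chart_in_model_series)
  have nz': "\<And>x. x \<in> \<phi> ` V \<Longrightarrow> \<Phi> V 0 f (\<lambda>_. 0) x \<noteq> 0"
    using nz by auto
  have "inverse_series ds (\<phi> ` V) (\<Phi> V 0 f) \<in> model_series n ds (\<phi> ` V) 0"
    using V(2) F nz' by (rule inverse_series_in_model_series)
  then obtain g where g: "g \<in> carrier (sec \<O> V 0)"
    and Fg: "\<Phi> V 0 g = inverse_series ds (\<phi> ` V) (\<Phi> V 0 f)"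
    using graded_chart_linear(2)[OF c, of 0] unfolding bij_betw_def by (metis imageE)
  have "\<Phi> V 0 (mul \<O> V 0 0 f g) = series_mult ds (\<Phi> V 0 f) (\<Phi> V 0 g)"
    using graded_chart_mul[OF c f g] by simp
  also have "\<dots> = \<Phi> V 0 (unit \<O> V)"
    unfolding Fg graded_chart_unit[OF c]
    using F nz' by (intro series_mult_inverse_series) (auto simp: model_series_def)
  finally have "mul \<O> V 0 0 f g = unit \<O> V"
    using graded_chart_linear(2)[OF c, of 0] mul_closed[OF V(1) f g] unit_in_sec[OF V(1)]
    by (auto simp: bij_betw_def inj_on_def)
  with g show ?thesis
    by blast
qed

text \<open>
  The value of a function at a point does not depend on the chart: otherwise, after subtracting a
  constant, it would be nonzero in one chart, hence invertible near the point, and zero in another.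
\<close>

lemma chart_value_unique:
  assumes c1: "graded_chart M \<O> n ds V \<phi> \<Phi>" and c2: "graded_chart M \<O> n ds V \<phi>' \<Phi>'"
    and x: "x \<in> V" and f: "f \<in> carrier (sec \<O> V 0)"
  shows "\<Phi> V 0 f (\<lambda>_. 0) (\<phi> x) = \<Phi>' V 0 f (\<lambda>_. 0) (\<phi>' x)"
proof (rule ccontr)
  assume ne: "\<Phi> V 0 f (\<lambda>_. 0) (\<phi> x) \<noteq> \<Phi>' V 0 f (\<lambda>_. 0) (\<phi>' x)"
  note V = graded_chart_open(1)[OF c1]
  let ?r = "\<Phi>' V 0 f (\<lambda>_. 0) (\<phi>' x)"
  let ?u = "(- ?r) \<odot>\<^bsub>sec \<O> V 0\<^esub> unit \<O> V"
  define h where "h = f \<oplus>\<^bsub>sec \<O> V 0\<^esub> ?u"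
  have u: "?u \<in> carrier (sec \<O> V 0)"
    using sec_vector_space[OF V] unit_in_sec[OF V] by (rule module_real_ring_smult_closed)
  then have h: "h \<in> carrier (sec \<O> V 0)"
    unfolding h_def by (intro module_real_ring_add_closed sec_vector_space V f)
  have h1: "\<Phi> V 0 h (\<lambda>_. 0) (\<phi> x) \<noteq> 0"
    using ne x unfolding h_def graded_chart_add[OF c1 f u]
      graded_chart_smult[OF c1 unit_in_sec[OF V]] graded_chart_unit[OF c1] by simp
  have h2: "\<Phi>' V 0 h (\<lambda>_. 0) (\<phi>' x) = 0"
    using x unfolding h_def graded_chart_add[OF c2 f u]
      graded_chart_smult[OF c2 unit_in_sec[OF V]] graded_chart_unit[OF c2] by simp
  define W where "W = {z \<in> V. \<Phi> V 0 h (\<lambda>_. 0) (\<phi> z) \<noteq> 0}"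
  have "smooth_fun_on n (\<phi> ` V) (\<Phi> V 0 h (\<lambda>_. 0))"
    using graded_chart_in_model_series[OF c1 h] by (simp add: model_series_def)
  then have "times_cont_diff n (\<phi> ` V) 0 (\<Phi> V 0 h (\<lambda>_. 0))"
    by (simp only: smooth_fun_on_def)
  then have "continuous_map (subtopology (Euclidean_space n) (\<phi> ` V)) euclideanreal
      (\<Phi> V 0 h (\<lambda>_. 0))"
    by simp
  moreover have "continuous_map (subtopology M V) (subtopology (Euclidean_space n) (\<phi> ` V)) \<phi>"
    using c1 by (simp add: graded_chart_def homeomorphic_imp_continuous_map)
  ultimately have "continuous_map (subtopology M V) euclideanreal
      (\<Phi> V 0 h (\<lambda>_. 0) \<circ> \<phi>)"
    by (blast intro: continuous_map_compose)
  then have "openin (subtopology M V) {z \<in> topspace (subtopology M V).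
      (\<Phi> V 0 h (\<lambda>_. 0) \<circ> \<phi>) z \<in> - {0}}"
    by (rule openin_continuous_map_preimage) (simp add: open_Compl)
  moreover have "{z \<in> topspace (subtopology M V). (\<Phi> V 0 h (\<lambda>_. 0) \<circ> \<phi>) z \<in> - {0}} = W"
    using openin_subset[OF V] by (auto simp: W_def)
  ultimately have "openin (subtopology M V) W"
    by simp
  then have W: "openin M W"
    using V by (simp add: openin_open_subtopology)
  have WV: "W \<subseteq> V" and xW: "x \<in> W"
    using x h1 by (auto simp: W_def)
  note c1' = graded_chart_subset[OF c1 W WV] and c2' = graded_chart_subset[OF c2 W WV]
  let ?k = "res \<O> V W 0 h"
  have k: "?k \<in> carrier (sec \<O> W 0)"
    using res_linear[OF V W WV, of 0] h by (auto simp: linear_map_def)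
  have "\<Phi> W 0 ?k (\<lambda>_. 0) (\<phi> z) \<noteq> 0" if "z \<in> W" for z
    using that by (simp add: graded_chart_res[OF c1 W WV h]) (simp add: W_def)
  then obtain g where g: "g \<in> carrier (sec \<O> W 0)" "mul \<O> W 0 0 ?k g = unit \<O> W"
    using chart_invertible[OF c1' k] by blast
  have "1 = \<Phi>' W 0 (mul \<O> W 0 0 ?k g) (\<lambda>_. 0) (\<phi>' x)"
    using xW by (simp add: g(2) graded_chart_unit[OF c2'])
  also have "\<dots> = \<Phi>' W 0 ?k (\<lambda>_. 0) (\<phi>' x) * \<Phi>' W 0 g (\<lambda>_. 0) (\<phi>' x)"
    using graded_chart_mul[OF c2' k g(1)] by (simp add: series_mult_zero)
  also have "\<dots> = 0"
    by (simp add: graded_chart_res[OF c2 W WV h] h2)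
  finally show False
    by simp
qed

lemma body_eq:
  assumes c: "graded_chart M \<O> n ds V \<phi> \<Phi>" and x: "x \<in> V" "V \<subseteq> U" and U: "openin M U"
    and f: "f \<in> carrier (sec \<O> U j)"
  shows "body M \<O> n ds U j f x = \<Phi> V j (res \<O> U V j f) (\<lambda>_. 0) (\<phi> x)"
  unfolding body_def
proof (rule the_equality)
  show "\<exists>V' \<phi>' \<Phi>'. graded_chart M \<O> n ds V' \<phi>' \<Phi>' \<and> x \<in> V' \<and> V' \<subseteq> U \<and>
      \<Phi> V j (res \<O> U V j f) (\<lambda>_. 0) (\<phi> x) = \<Phi>' V' j (res \<O> U V' j f) (\<lambda>_. 0) (\<phi>' x)"
    using c x by blast
next
  fix r assume "\<exists>V' \<phi>' \<Phi>'. graded_chart M \<O> n ds V' \<phi>' \<Phi>' \<and> x \<in> V' \<and> V' \<subseteq> U \<and>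
      r = \<Phi>' V' j (res \<O> U V' j f) (\<lambda>_. 0) (\<phi>' x)"
  then obtain V' \<phi>' \<Phi>' where c': "graded_chart M \<O> n ds V' \<phi>' \<Phi>'" and x': "x \<in> V'" "V' \<subseteq> U"
    and r: "r = \<Phi>' V' j (res \<O> U V' j f) (\<lambda>_. 0) (\<phi>' x)"
    by blast
  note V = graded_chart_open(1)[OF c] and V' = graded_chart_open(1)[OF c']
  have fV: "res \<O> U V j f \<in> carrier (sec \<O> V j)" and fV': "res \<O> U V' j f \<in> carrier (sec \<O> V' j)"
    using res_linear[OF U V x(2), of j] res_linear[OF U V' x'(2), of j] f
    by (auto simp: linear_map_def)
  show "r = \<Phi> V j (res \<O> U V j f) (\<lambda>_. 0) (\<phi> x)"
  proof (cases "j = 0")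
    case False
    then have "\<Phi> V j (res \<O> U V j f) (\<lambda>_. 0) (\<phi> x) = 0" "\<Phi>' V' j (res \<O> U V' j f) (\<lambda>_. 0) (\<phi>' x) = 0"
      using graded_chart_in_model_series[OF c fV] graded_chart_in_model_series[OF c' fV']
      by (auto simp: model_series_def monomial_degree_def)
    then show ?thesis
      by (simp add: r)
  next
    case True
    let ?W = "V \<inter> V'"
    have W: "openin M ?W" "?W \<subseteq> V" "?W \<subseteq> V'" "x \<in> ?W" "?W \<subseteq> U"
      using V V' x x' by auto
    have fW: "res \<O> U ?W j f \<in> carrier (sec \<O> ?W j)"
      using res_linear[OF U W(1,5), of j] f by (auto simp: linear_map_def)
    have "\<Phi> ?W j (res \<O> U ?W j f) (\<lambda>_. 0) (\<phi> x) = \<Phi>' ?W j (res \<O> U ?W j f) (\<lambda>_. 0) (\<phi>' x)"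
      using chart_value_unique[OF graded_chart_subset[OF c W(1,2)] graded_chart_subset[OF c' W(1,3)]
          W(4)] fW True by simp
    moreover have "\<Phi> ?W j (res \<O> U ?W j f) (\<lambda>_. 0) (\<phi> x) = \<Phi> V j (res \<O> U V j f) (\<lambda>_. 0) (\<phi> x)"
      using graded_chart_res[OF c W(1,2) fV] res_comp[OF U V W(1) x(2) W(2) f] W(4) by simp
    moreover have "\<Phi>' ?W j (res \<O> U ?W j f) (\<lambda>_. 0) (\<phi>' x) = \<Phi>' V' j (res \<O> U V' j f) (\<lambda>_. 0) (\<phi>' x)"
      using graded_chart_res[OF c' W(1,3) fV'] res_comp[OF U V' W(1) x'(2) W(3) f] W(4) by simp
    ultimately show ?thesis
      by (simp add: r)
  qed
qed

end

section \<open>Generated submodules\<close>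

lemma generated_submodule_subset:
  "graded_submodule A P \<alpha> N \<Longrightarrow> (\<And>i. S i \<subseteq> N i) \<Longrightarrow> generated_submodule A P \<alpha> S j \<subseteq> N j"
  unfolding generated_submodule_def by blast

lemma zero_in_generated_submodule: "\<zero>\<^bsub>P j\<^esub> \<in> generated_submodule A P \<alpha> S j"
proof -
  have "\<zero>\<^bsub>P j\<^esub> \<in> N" if "submodule N real_ring (P j)" for N
    using subgroup.one_closed[OF submodule.axioms(1)[OF that]] by simp
  then show ?thesis
    by (auto simp: generated_submodule_def graded_submodule_def)
qed

section \<open>Tensor classes\<close>

lemma tensor_class_self: "set_mset x \<subseteq> elementary_tensors A K j \<Longrightarrow> x \<in> tensor_class A K j x"
  by (simp add: tensor_class_def tensor_eq.refl)

lemma tensor_class_eqI: "tensor_eq A K j x y \<Longrightarrow> tensor_class A K j x = tensor_class A K j y"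
  unfolding tensor_class_def by (blast intro: tensor_eq.sym tensor_eq.trans)

lemma tensor_eval_class:
  assumes "y \<in> tensor_class A K j x" "Module.module real_ring (A i)"
    "linear_functional (A i) e" "linear_functional (K (j - i)) l"
  shows "tensor_eval i l e y = tensor_eval i l e x"
  using tensor_eval_cong[of A K j x y i e l] assms by (simp add: tensor_class_def)

lemma tensor_eval_smult:
  assumes "set_mset x \<subseteq> elementary_tensors A K j" "linear_functional (A i) e"
  shows "tensor_eval i l e (image_mset (\<lambda>(i, f, k). (i, r \<odot>\<^bsub>A i\<^esub> f, k)) x) = r * tensor_eval i l e x"
  using assms(1)
proof (induction x)
  case (add t x)
  then show ?case
    using assms(2)
    by (cases t) (auto simp: elementary_tensors_def linear_functional_def algebra_simps)
qed simp

lemma tensor_space_elementary: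
  assumes "\<And>i. Module.module real_ring (A i)" "\<And>d. Module.module real_ring (K d)"
    and "C \<in> carrier (tensor_space A K j)" "x \<in> C"
  shows "set_mset x \<subseteq> elementary_tensors A K j"
proof -
  obtain x' where "C = tensor_class A K j x'"
    using assms(3) by (auto simp: tensor_space_def)
  then have "tensor_eq A K j x' x"
    using assms(4) by (simp add: tensor_class_def)
  from tensor_eq_elementary[OF assms(1,2) this] show ?thesis
    by simp
qed

section \<open>Sections over a trivialising chart\<close>

text \<open>
  An open set \<open>W \<subseteq> U\<close> that is the domain of a chart of the base and of a trivialisation of the bundle
  with fibre \<open>K\<close>. Functions and sections over \<open>U\<close> are studied through their restrictions to \<open>W\<close>.
\<close>

locale trivialised_chart = \<O>: sheaf_of_graded_algebras M \<O> + E: sheaf_of_graded_modules M \<O> E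
  for M :: "'p topology" and \<O> :: "('p, 'a) galgebra_sheaf" and E :: "('p, 'a, 'e) gmodule_sheaf" +
  fixes K :: "int \<Rightarrow> (real, 'k) module"
    and n :: nat and ds :: "int list" and W U :: "'p set"
    and \<phi> :: "'p \<Rightarrow> nat \<Rightarrow> real" and \<Phi> :: "'p set \<Rightarrow> int \<Rightarrow> 'a \<Rightarrow> power_series"
    and \<Psi> :: "'p set \<Rightarrow> int \<Rightarrow> 'e \<Rightarrow> ('a, 'k) formal_tensor set"
  assumes K: "finite_dim_graded K"
    and chart: "graded_chart M \<O> n ds W \<phi> \<Phi>"
    and triv: "gmodule_sheaf_iso M W \<O> E (tensor_sheaf \<O> K) \<Psi>"
    and U: "openin M U" and WU: "W \<subseteq> U"
begin

lemma W: "openin M W"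
  using chart by (rule graded_chart_open)

lemma K_module: "Module.module real_ring (K d)"
  using K by (simp add: finite_dim_graded_def)

lemma W_module: "Module.module real_ring (sec \<O> W j)"
  using W by (rule \<O>.sec_vector_space)

text \<open>The power series of the restriction to \<open>W\<close> of a function over \<open>U\<close>.\<close>

abbreviation (input) coefficient :: "int \<Rightarrow> 'a \<Rightarrow> power_series"
  where "coefficient j f \<equiv> \<Phi> W j (res \<O> U W j f)"

text \<open>
  The element of \<open>\<O>(W) \<otimes> K\<close> corresponding to the restriction to \<open>W\<close> of a section over \<open>U\<close>, as a class
  of formal tensors.
\<close>

abbreviation (input) local_tensor :: "int \<Rightarrow> 'e \<Rightarrow> ('a, 'k) formal_tensor set"
  where "local_tensor j s \<equiv> \<Psi> W j (res E U W j s)"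

lemma res_closed: "f \<in> carrier (sec \<O> U j) \<Longrightarrow> res \<O> U W j f \<in> carrier (sec \<O> W j)"
  using \<O>.res_linear[OF U W WU, of j] by (auto simp: linear_map_def)

lemma E_res_closed: "s \<in> carrier (sec E U j) \<Longrightarrow> res E U W j s \<in> carrier (sec E W j)"
  using E.res_linear[OF U W WU, of j] by (auto simp: linear_map_def)

lemma triv_linear:
  "linear_map (sec E W j) (tensor_space (sec \<O> W) K j) (\<Psi> W j)"
  "bij_betw (\<Psi> W j) (carrier (sec E W j)) (carrier (tensor_space (sec \<O> W) K j))"
  using triv W by (simp_all add: gmodule_sheaf_iso_def gsheaf_iso_def tensor_sheaf_def)

lemma local_tensor_closed:
  "s \<in> carrier (sec E U j) \<Longrightarrow> local_tensor j s \<in> carrier (tensor_space (sec \<O> W) K j)"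
  using triv_linear(1)[of j] E_res_closed by (auto simp: linear_map_def)

lemma local_tensor_elementary:
  "s \<in> carrier (sec E U j) \<Longrightarrow> x \<in> local_tensor j s \<Longrightarrow> set_mset x \<subseteq> elementary_tensors (sec \<O> W) K j"
  by (rule tensor_space_elementary[OF W_module K_module local_tensor_closed])

lemma local_tensor_add:
  assumes "s \<in> carrier (sec E U j)" "t \<in> carrier (sec E U j)"
  shows "local_tensor j (s \<oplus>\<^bsub>sec E U j\<^esub> t) =
    (\<Union>x\<in>local_tensor j s. \<Union>y\<in>local_tensor j t. tensor_class (sec \<O> W) K j (x + y))"
proof -
  have "res E U W j (s \<oplus>\<^bsub>sec E U j\<^esub> t) = res E U W j s \<oplus>\<^bsub>sec E W j\<^esub> res E U W j t"
    using E.res_linear[OF U W WU, of j] assms by (simp add: linear_map_def)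
  then show ?thesis
    using triv_linear(1)[of j] E_res_closed assms by (simp add: linear_map_def tensor_space_def)
qed

lemma local_tensor_smult:
  assumes "s \<in> carrier (sec E U j)"
  shows "local_tensor j (r \<odot>\<^bsub>sec E U j\<^esub> s) =
    (\<Union>x\<in>local_tensor j s. tensor_class (sec \<O> W) K j
      (image_mset (\<lambda>(i, f, k). (i, r \<odot>\<^bsub>sec \<O> W i\<^esub> f, k)) x))"
proof -
  have "res E U W j (r \<odot>\<^bsub>sec E U j\<^esub> s) = r \<odot>\<^bsub>sec E W j\<^esub> res E U W j s"
    using E.res_linear[OF U W WU, of j] assms by (simp add: linear_map_def)
  then show ?thesis
    using triv_linear(1)[of j] E_res_closed assms
    by (simp add: linear_map_def tensor_space_def tensor_lift_def)
qed

lemma local_tensor_act: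
  assumes "f \<in> carrier (sec \<O> U l)" "s \<in> carrier (sec E U j)"
  shows "local_tensor (l + j) (act E U l j f s) =
    (\<Union>x\<in>local_tensor j s. tensor_class (sec \<O> W) K (l + j)
      (image_mset (\<lambda>(i, g, k). (l + i, mul \<O> W l i (res \<O> U W l f) g, k)) x))"
proof -
  have "\<Psi> W (l + j) (act E W l j g t) = act (tensor_sheaf \<O> K) W l j g (\<Psi> W j t)"
    if "g \<in> carrier (sec \<O> W l)" "t \<in> carrier (sec E W j)" for g t
    using triv W that by (simp add: gmodule_sheaf_iso_def)
  then show ?thesis
    using E.res_act[OF U W WU assms] res_closed[OF assms(1)] E_res_closed[OF assms(2)]
    by (simp add: tensor_sheaf_def tensor_lift_def)
qed

lemma act_closed:
  assumes "f \<in> carrier (sec \<O> U l)" "s \<in> carrier (sec E U j)"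
  shows "act E U l j f s \<in> carrier (sec E U (l + j))"
proof -
  interpret graded_module "sec \<O> U" "mul \<O> U" "unit \<O> U" "sec E U" "act E U"
    using U by (rule E.sec_module)
  show ?thesis
    using act_linear_right[OF assms(1), of j] assms(2) by (auto simp: linear_map_def)
qed

lemma coefficient_mul:
  assumes "f \<in> carrier (sec \<O> U i)" "g \<in> carrier (sec \<O> U j)"
  shows "coefficient (i + j) (mul \<O> U i j f g) = series_mult ds (coefficient i f) (coefficient j g)"
  using \<O>.res_mul[OF U W WU assms] graded_chart_mul[OF chart] res_closed assms by simp

text \<open>
  The functions whose coefficients at \<open>a\<close> vanish in all total degrees below \<open>q\<close> in the graded
  variables.
\<close>

definition order_ideal :: "'p \<Rightarrow> nat \<Rightarrow> int \<Rightarrow> 'a set"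
  where "order_ideal a q i = {f \<in> carrier (sec \<O> U i).
    \<forall>r. monomial_size ds r < q \<longrightarrow> coefficient i f r (\<phi> a) = 0}"

lemma coefficient_add:
  assumes "f \<in> carrier (sec \<O> U i)" "g \<in> carrier (sec \<O> U i)"
  shows "coefficient i (f \<oplus>\<^bsub>sec \<O> U i\<^esub> g) p x = coefficient i f p x + coefficient i g p x"
  using \<O>.res_linear[OF U W WU, of i] graded_chart_add[OF chart] res_closed assms
  by (simp add: linear_map_def)

lemma coefficient_smult:
  assumes "f \<in> carrier (sec \<O> U i)"
  shows "coefficient i (r \<odot>\<^bsub>sec \<O> U i\<^esub> f) p x = r * coefficient i f p x"
  using \<O>.res_linear[OF U W WU, of i] graded_chart_smult[OF chart] res_closed assms
  by (simp add: linear_map_def)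

lemma graded_submodule_order_ideal:
  "graded_submodule (sec \<O> U) (sec \<O> U) (mul \<O> U) (order_ideal a q)"
  unfolding graded_submodule_def
proof (intro conjI allI ballI)
  fix j
  note V = \<O>.sec_vector_space[OF U, of j]
  have lin: "linear_functional (sec \<O> U j) (\<lambda>f. coefficient j f p x)" for p x
    by (simp add: linear_functional_def coefficient_add coefficient_smult)
  show "submodule (order_ideal a q j) real_ring (sec \<O> U j)"
  proof (rule submodule_real_ringI[OF V])
    show "\<zero>\<^bsub>sec \<O> U j\<^esub> \<in> order_ideal a q j"
      using linear_functional_zero[OF V lin] module_real_ring_zero_closed[OF V]
      by (simp add: order_ideal_def)
  qed (auto simp: order_ideal_def coefficient_add coefficient_smult
      intro: module_real_ring_add_closed[OF V] module_real_ring_smult_closed[OF V])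
next
  fix i j f g assume f: "f \<in> carrier (sec \<O> U i)" and g: "g \<in> order_ideal a q j"
  then have "g \<in> carrier (sec \<O> U j)"
    by (simp add: order_ideal_def)
  then show "mul \<O> U i j f g \<in> order_ideal a q (i + j)"
    using g \<O>.mul_closed[OF U f]
    by (auto simp: order_ideal_def coefficient_mul[OF f] intro: series_mult_eq_zero_right)
qed

lemma ideal_power_subset_order_ideal:
  assumes a: "a \<in> W"
  shows "ideal_power (sec \<O> U) (mul \<O> U) (vanishing_ideal M \<O> n ds U a) q i \<subseteq> order_ideal a q i"
proof (induction q arbitrary: i)
  case 0
  then show ?case
    by (simp add: order_ideal_def)
next
  case (Suc q)
  show ?case
    unfolding ideal_power.simps
  proof (rule generated_submodule_subset[OF graded_submodule_order_ideal], clarify)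
    fix i k f g
    assume f: "f \<in> ideal_power (sec \<O> U) (mul \<O> U) (vanishing_ideal M \<O> n ds U a) q i"
      and g: "g \<in> vanishing_ideal M \<O> n ds U a k"
    have f': "f \<in> order_ideal a q i" "f \<in> carrier (sec \<O> U i)"
      using f Suc by (auto simp: order_ideal_def)
    have g': "g \<in> carrier (sec \<O> U k)" "coefficient k g (\<lambda>_. 0) (\<phi> a) = 0"
      using g \<O>.body_eq[OF chart a WU U, of g k] by (auto simp: vanishing_ideal_def)
    show "mul \<O> U i k f g \<in> order_ideal a (Suc q) (i + k)"
      using f' g' \<O>.mul_closed[OF U f'(2) g'(1)]
      by (auto simp: order_ideal_def coefficient_mul intro: series_mult_eq_zero_Suc)
  qed
qed

text \<open>Contracting the product of a function with a tensor expands like a product of series.\<close>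

lemma tensor_eval_mul:
  assumes "f \<in> carrier (sec \<O> W l)" "set_mset x \<subseteq> elementary_tensors (sec \<O> W) K j"
  shows "tensor_eval i h (\<lambda>g. \<Phi> W i g r y)
      (image_mset (\<lambda>(i', g, k). (l + i', mul \<O> W l i' f g, k)) x) =
    (if r \<in> multi_indices ds
     then \<Sum>s | \<forall>i. s i \<le> r i. monomial_sign ds s (\<lambda>i. r i - s i) * \<Phi> W l f s y *
       tensor_eval (i - l) h (\<lambda>g. \<Phi> W (i - l) g (\<lambda>i. r i - s i) y) x
     else 0)"
  using assms(2)
proof (induction x)
  case (add t x)
  obtain i' g k where t: "t = (i', g, k)"
    by (cases t)
  have IH: "tensor_eval i h (\<lambda>g. \<Phi> W i g r y)
      (image_mset (\<lambda>(i', g, k). (l + i', mul \<O> W l i' f g, k)) x) =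
    (if r \<in> multi_indices ds
     then \<Sum>s | \<forall>i. s i \<le> r i. monomial_sign ds s (\<lambda>i. r i - s i) * \<Phi> W l f s y *
       tensor_eval (i - l) h (\<lambda>g. \<Phi> W (i - l) g (\<lambda>i. r i - s i) y) x
     else 0)"
    using add by simp
  show ?case
  proof (cases "i' = i - l")
    case True
    have "g \<in> carrier (sec \<O> W i')"
      using add.prems by (simp add: t elementary_tensors_def)
    then have "\<Phi> W i (mul \<O> W l i' f g) = series_mult ds (\<Phi> W l f) (\<Phi> W i' g)"
      using graded_chart_mul[OF chart assms(1), of g i'] True by simp
    then show ?thesis
      using True unfolding t
      by (simp add: IH series_mult_def sum_distrib_right distrib_left sum.distrib mult.assoc)
  next
    case False
    then have "l + i' \<noteq> i"
      by auto
    then show ?thesis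
      using False unfolding t by (simp add: IH)
  qed
qed simp

text \<open>
  The sections all of whose contractions with functionals of the fibre have coefficients at \<open>a\<close>
  vanishing in total degrees below \<open>q\<close>.
\<close>

definition order_submodule :: "'p \<Rightarrow> nat \<Rightarrow> int \<Rightarrow> 'e set"
  where "order_submodule a q j = {s \<in> carrier (sec E U j).
    \<forall>i h r. linear_functional (K (j - i)) h \<longrightarrow> monomial_size ds r < q \<longrightarrow>
      (\<forall>x\<in>local_tensor j s. tensor_eval i h (\<lambda>f. \<Phi> W i f r (\<phi> a)) x = 0)}"

text \<open>Here \<open>z\<close> represents \<open>f \<cdot> s\<close>, and the witness \<open>x\<close> represents \<open>s\<close>.\<close>

lemma local_tensor_act_eval:
  assumes f: "f \<in> carrier (sec \<O> U l)" and s: "s \<in> carrier (sec E U j)"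
    and h: "linear_functional (K (l + j - i)) h" and z: "z \<in> local_tensor (l + j) (act E U l j f s)"
  obtains x where "x \<in> local_tensor j s"
    "tensor_eval i h (\<lambda>g. \<Phi> W i g r y) z =
      (if r \<in> multi_indices ds
       then \<Sum>s | \<forall>i. s i \<le> r i. monomial_sign ds s (\<lambda>i. r i - s i) * coefficient l f s y *
         tensor_eval (i - l) h (\<lambda>g. \<Phi> W (i - l) g (\<lambda>i. r i - s i) y) x
       else 0)"
proof -
  obtain x where x: "x \<in> local_tensor j s" and zx: "z \<in> tensor_class (sec \<O> W) K (l + j)
      (image_mset (\<lambda>(i, g, k). (l + i, mul \<O> W l i (res \<O> U W l f) g, k)) x)"
    using z unfolding local_tensor_act[OF f s] by blast
  show ?thesis
    using that[OF x] tensor_eval_class[OF zx W_module graded_chart_functional[OF chart] h]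
      tensor_eval_mul[OF res_closed[OF f] local_tensor_elementary[OF s x]] by simp
qed

lemma graded_submodule_order_submodule:
  "graded_submodule (sec \<O> U) (sec E U) (act E U) (order_submodule a q)"
  unfolding graded_submodule_def
proof (intro conjI allI ballI)
  fix j
  note V = E.sec_vector_space[OF U, of j]
  note lin = graded_chart_functional[OF chart]
  have smult: "tensor_eval i h (\<lambda>f. \<Phi> W i f r y) z = 0"
    if s: "s \<in> carrier (sec E U j)" and h: "linear_functional (K (j - i)) h"
      and z: "z \<in> local_tensor j (c \<odot>\<^bsub>sec E U j\<^esub> s)"
      and 0: "\<And>x. x \<in> local_tensor j s \<Longrightarrow> c * tensor_eval i h (\<lambda>f. \<Phi> W i f r y) x = 0"
    for s i h z c r y
  proof -
    obtain x where x: "x \<in> local_tensor j s" and zx: "z \<in> tensor_class (sec \<O> W) K j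
        (image_mset (\<lambda>(i, f, k). (i, c \<odot>\<^bsub>sec \<O> W i\<^esub> f, k)) x)"
      using z unfolding local_tensor_smult[OF s] by blast
    show ?thesis
      using tensor_eval_class[OF zx W_module lin h] 0[OF x]
        tensor_eval_smult[OF local_tensor_elementary[OF s x] lin] by simp
  qed
  show "submodule (order_submodule a q j) real_ring (sec E U j)"
  proof (rule submodule_real_ringI[OF V])
    show "order_submodule a q j \<subseteq> carrier (sec E U j)"
      by (auto simp: order_submodule_def)
    have z: "\<zero>\<^bsub>sec E U j\<^esub> \<in> carrier (sec E U j)"
      using V by (rule module_real_ring_zero_closed)
    have "\<zero>\<^bsub>sec E U j\<^esub> = 0 \<odot>\<^bsub>sec E U j\<^esub> \<zero>\<^bsub>sec E U j\<^esub>"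
      using V z by (simp add: module_real_ring_smult_zero)
    then show "\<zero>\<^bsub>sec E U j\<^esub> \<in> order_submodule a q j"
      using z smult[OF z, where c = 0] by (auto simp: order_submodule_def)
  next
    fix s t assume st: "s \<in> order_submodule a q j" "t \<in> order_submodule a q j"
    then have st': "s \<in> carrier (sec E U j)" "t \<in> carrier (sec E U j)"
      by (auto simp: order_submodule_def)
    have "tensor_eval i h (\<lambda>f. \<Phi> W i f r (\<phi> a)) z = 0"
      if h: "linear_functional (K (j - i)) h" and r: "monomial_size ds r < q"
        and z: "z \<in> local_tensor j (s \<oplus>\<^bsub>sec E U j\<^esub> t)" for i h r z
    proof -
      obtain x y where xy: "x \<in> local_tensor j s" "y \<in> local_tensor j t"
        and z': "z \<in> tensor_class (sec \<O> W) K j (x + y)"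
        using z unfolding local_tensor_add[OF st'] by blast
      show ?thesis
        using tensor_eval_class[OF z' W_module lin h] st xy h r
        by (simp add: tensor_eval_plus order_submodule_def)
    qed
    then show "s \<oplus>\<^bsub>sec E U j\<^esub> t \<in> order_submodule a q j"
      using st' V by (simp add: order_submodule_def module_real_ring_add_closed)
  next
    fix c s assume s: "s \<in> order_submodule a q j"
    then have s': "s \<in> carrier (sec E U j)"
      by (auto simp: order_submodule_def)
    have "tensor_eval i h (\<lambda>f. \<Phi> W i f r (\<phi> a)) z = 0"
      if "linear_functional (K (j - i)) h" "monomial_size ds r < q"
        "z \<in> local_tensor j (c \<odot>\<^bsub>sec E U j\<^esub> s)" for i h r z
      using s that by (intro smult[OF s' that(1,3)]) (simp add: order_submodule_def)
    then show "c \<odot>\<^bsub>sec E U j\<^esub> s \<in> order_submodule a q j"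
      using s' V by (simp add: order_submodule_def module_real_ring_smult_closed)
  qed
next
  fix l j f s assume f: "f \<in> carrier (sec \<O> U l)" and s: "s \<in> order_submodule a q j"
  then have s': "s \<in> carrier (sec E U j)"
    by (simp add: order_submodule_def)
  have "tensor_eval i h (\<lambda>g. \<Phi> W i g r (\<phi> a)) z = 0"
    if h: "linear_functional (K (l + j - i)) h" and r: "monomial_size ds r < q"
      and z: "z \<in> local_tensor (l + j) (act E U l j f s)" for i h r z
  proof -
    obtain x where x: "x \<in> local_tensor j s"
      and eq: "tensor_eval i h (\<lambda>g. \<Phi> W i g r (\<phi> a)) z =
        (if r \<in> multi_indices ds
         then \<Sum>s | \<forall>i. s i \<le> r i. monomial_sign ds s (\<lambda>i. r i - s i) * coefficient l f s (\<phi> a) *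
           tensor_eval (i - l) h (\<lambda>g. \<Phi> W (i - l) g (\<lambda>i. r i - s i) (\<phi> a)) x
         else 0)"
      using local_tensor_act_eval[OF f s' h z] by blast
    have "tensor_eval (i - l) h (\<lambda>g. \<Phi> W (i - l) g (\<lambda>i. r i - t i) (\<phi> a)) x = 0"
      for t :: "nat \<Rightarrow> nat"
    proof -
      have "monomial_size ds (\<lambda>i. r i - t i) \<le> monomial_size ds r"
        by (rule monomial_size_mono) simp
      moreover have "linear_functional (K (j - (i - l))) h"
        using h by (simp add: algebra_simps)
      ultimately show ?thesis
        using s r x by (simp add: order_submodule_def)
    qed
    then show ?thesis
      by (simp add: eq)
  qed
  then show "act E U l j f s \<in> order_submodule a q (l + j)"
    using act_closed[OF f s'] by (simp add: order_submodule_def)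
qed

lemma ideal_power_submodule_subset:
  assumes a: "a \<in> W"
  shows "ideal_power_submodule (sec \<O> U) (mul \<O> U) (vanishing_ideal M \<O> n ds U a)
    (sec E U) (act E U) q j \<subseteq> order_submodule a q j"
  unfolding ideal_power_submodule_def
proof (rule generated_submodule_subset[OF graded_submodule_order_submodule], clarify)
  fix l j f s
  assume "f \<in> ideal_power (sec \<O> U) (mul \<O> U) (vanishing_ideal M \<O> n ds U a) q l"
    and s: "s \<in> carrier (sec E U j)"
  then have fo: "f \<in> order_ideal a q l"
    using ideal_power_subset_order_ideal[OF a] by blast
  then have f: "f \<in> carrier (sec \<O> U l)"
    by (simp add: order_ideal_def)
  have "tensor_eval i h (\<lambda>g. \<Phi> W i g r (\<phi> a)) z = 0"
    if h: "linear_functional (K (l + j - i)) h" and r: "monomial_size ds r < q"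
      and z: "z \<in> local_tensor (l + j) (act E U l j f s)" for i h r z
  proof -
    obtain x where eq: "tensor_eval i h (\<lambda>g. \<Phi> W i g r (\<phi> a)) z =
        (if r \<in> multi_indices ds
         then \<Sum>s | \<forall>i. s i \<le> r i. monomial_sign ds s (\<lambda>i. r i - s i) * coefficient l f s (\<phi> a) *
           tensor_eval (i - l) h (\<lambda>g. \<Phi> W (i - l) g (\<lambda>i. r i - s i) (\<phi> a)) x
         else 0)"
      using local_tensor_act_eval[OF f s h z] by blast
    have "coefficient l f t (\<phi> a) = 0" if "\<forall>i. t i \<le> r i" for t
    proof -
      have "monomial_size ds t \<le> monomial_size ds r"
        using that by (intro monomial_size_mono) simp
      then show ?thesis
        using fo r by (simp add: order_ideal_def)
    qed
    then show ?thesis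
      by (simp add: eq)
  qed
  then show "act E U l j f s \<in> order_submodule a q (l + j)"
    using act_closed[OF f s] by (simp add: order_submodule_def)
qed

lemma invisible_local_tensor:
  assumes "s \<in> invisible_part M \<O> n ds U (sec E U) (act E U) j"
  shows "local_tensor j s = tensor_class (sec \<O> W) K j {#}"
proof -
  have s: "s \<in> carrier (sec E U j)"
    using assms by (simp add: invisible_part_def)
  have so: "s \<in> order_submodule a q j" if "a \<in> W" for a q
  proof -
    have "a \<in> U"
      using that WU by blast
    then have "s \<in> ideal_power_submodule (sec \<O> U) (mul \<O> U) (vanishing_ideal M \<O> n ds U a)
        (sec E U) (act E U) q j"
      using assms by (simp add: invisible_part_def)
    then show ?thesis
      using ideal_power_submodule_subset[OF that] by blast
  qed
  obtain x where x: "local_tensor j s = tensor_class (sec \<O> W) K j x"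
    "set_mset x \<subseteq> elementary_tensors (sec \<O> W) K j"
    using local_tensor_closed[OF s] by (auto simp: tensor_space_def)
  then have xs: "x \<in> local_tensor j s"
    by (simp add: tensor_class_self)
  define Ev where "Ev i = {(\<lambda>f. \<Phi> W i f r (\<phi> a)) | r a. a \<in> W}" for i
  have "tensor_eq (sec \<O> W) K j x {#}"
  proof (rule tensor_eq_emptyI[OF W_module K _ _ x(2), of Ev])
    show "linear_functional (sec \<O> W i) e" if "e \<in> Ev i" for i e
      using that graded_chart_functional[OF chart] by (auto simp: Ev_def)
    show "f = \<zero>\<^bsub>sec \<O> W i\<^esub>" if f: "f \<in> carrier (sec \<O> W i)" and e: "\<And>e. e \<in> Ev i \<Longrightarrow> e f = 0" for i f
    proof -
      have z: "\<zero>\<^bsub>sec \<O> W i\<^esub> \<in> carrier (sec \<O> W i)"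
        using W_module by (rule module_real_ring_zero_closed)
      have "\<Phi> W i f r y = \<Phi> W i \<zero>\<^bsub>sec \<O> W i\<^esub> r y" for r y
      proof -
        have "\<Phi> W i f r y = 0"
        proof (cases "y \<in> \<phi> ` W")
          case True
          then obtain a where a: "a \<in> W" "y = \<phi> a"
            by blast
          then show ?thesis
            using e[of "\<lambda>f. \<Phi> W i f r (\<phi> a)"] unfolding Ev_def by blast
        next
          case False
          then show ?thesis
            using graded_chart_in_model_series[OF chart f] by (simp add: model_series_def)
        qed
        then show ?thesis
          using linear_functional_zero[OF W_module graded_chart_functional[OF chart]] by simp
      qed
      then have "\<Phi> W i f = \<Phi> W i \<zero>\<^bsub>sec \<O> W i\<^esub>"
        by (intro ext)
      then show ?thesis
        using graded_chart_linear(2)[OF chart, of i] f z by (auto simp: bij_betw_def inj_on_def)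
    qed
    show "tensor_eval i h e x = 0" if h: "linear_functional (K (j - i)) h" and e: "e \<in> Ev i" for i h e
    proof -
      obtain r a where e': "e = (\<lambda>f. \<Phi> W i f r (\<phi> a))" "a \<in> W"
        using e by (auto simp: Ev_def)
      \<comment> \<open>Any order beyond the total degree of \<open>r\<close> forces the coefficient of \<open>\<xi>\<^sup>r\<close> to vanish.\<close>
      show ?thesis
        using so[OF e'(2), of "Suc (monomial_size ds r)"] h xs
        by (simp add: order_submodule_def e'(1))
    qed
  qed
  then show ?thesis
    unfolding x(1) by (rule tensor_class_eqI)
qed

lemma invisible_res_eq:
  assumes "s \<in> invisible_part M \<O> n ds U (sec E U) (act E U) j"
    and "t \<in> invisible_part M \<O> n ds U (sec E U) (act E U) j"
  shows "res E U W j s = res E U W j t"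
proof -
  have "local_tensor j s = local_tensor j t"
    using assms by (simp add: invisible_local_tensor)
  moreover have "s \<in> carrier (sec E U j)" "t \<in> carrier (sec E U j)"
    using assms by (auto simp: invisible_part_def)
  ultimately show ?thesis
    using triv_linear(2)[of j] E_res_closed by (auto simp: bij_betw_def inj_on_def)
qed

end

section \<open>Geometricity\<close>

lemma gmodule_sheaf_iso_subset:
  assumes "gmodule_sheaf_iso M V \<O> E E' \<Psi>" "W \<subseteq> V"
  shows "gmodule_sheaf_iso M W \<O> E E' \<Psi>"
  using assms unfolding gmodule_sheaf_iso_def gsheaf_iso_def by (meson subset_trans)

theorem proposition6p3:
  fixes M :: "'p topology"
    and \<O> :: "('p, 'a) galgebra_sheaf"
    and K :: "int \<Rightarrow> (real, 'k) module"
    and E :: "('p, 'a, 'e) gmodule_sheaf"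
    and n :: nat and ds :: "int list"
  assumes "graded_manifold M \<O> n ds"
    and "graded_vector_bundle M \<O> K E"
  shows "geometric M \<O> n ds E"
  unfolding geometric_def geometric_module_def
proof (intro allI impI)
  fix U j assume U: "openin M U"
  interpret \<O>: sheaf_of_graded_algebras M \<O>
    using assms(1) by (simp add: graded_manifold_def)
  interpret E: sheaf_of_graded_modules M \<O> E
    using assms(2) by (simp add: graded_vector_bundle_def)
  let ?I = "invisible_part M \<O> n ds U (sec E U) (act E U) j"
  have zero: "\<zero>\<^bsub>sec E U j\<^esub> \<in> ?I"
    using module_real_ring_zero_closed[OF E.sec_vector_space[OF U]]
    by (auto simp: invisible_part_def ideal_power_submodule_def zero_in_generated_submodule)
  define \<U> where "\<U> = {W. openin M W \<and> W \<subseteq> U \<and>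
    (\<forall>s\<in>?I. \<forall>t\<in>?I. res E U W j s = res E U W j t)}"
  have "\<exists>W\<in>\<U>. x \<in> W" if x: "x \<in> U" for x
  proof -
    have "x \<in> topspace M"
      using x U openin_subset by blast
    obtain V \<phi> \<Phi> where V: "x \<in> V" "graded_chart M \<O> n ds V \<phi> \<Phi>"
      using assms(1) \<open>x \<in> topspace M\<close> unfolding graded_manifold_def by blast
    obtain V' \<Psi> where V': "openin M V'" "x \<in> V'" "gmodule_sheaf_iso M V' \<O> E (tensor_sheaf \<O> K) \<Psi>"
      using assms(2) \<open>x \<in> topspace M\<close> unfolding graded_vector_bundle_def by blast
    let ?W = "U \<inter> V \<inter> V'"
    have W: "openin M ?W"
      using U V'(1) graded_chart_open(1)[OF V(2)] by blast
    interpret trivialised_chart M \<O> E K n ds ?W U \<phi> \<Phi> \<Psi>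
    proof
      show "finite_dim_graded K"
        using assms(2) by (simp add: graded_vector_bundle_def)
      show "graded_chart M \<O> n ds ?W \<phi> \<Phi>"
        using V(2) W by (rule graded_chart_subset) blast
      show "gmodule_sheaf_iso M ?W \<O> E (tensor_sheaf \<O> K) \<Psi>"
        using V'(3) by (rule gmodule_sheaf_iso_subset) blast
    qed (use U in auto)
    have "?W \<in> \<U>"
      using W invisible_res_eq unfolding \<U>_def by blast
    moreover have "x \<in> ?W"
      using x V(1) V'(2) by simp
    ultimately show ?thesis
      by (rule bexI[rotated])
  qed
  moreover have "W \<subseteq> U" if "W \<in> \<U>" for W
    using that by (simp add: \<U>_def)
  ultimately have Un: "\<Union>\<U> = U"
    by blast
  \<comment> \<open>For \<open>U = {}\<close>, where \<open>?I\<close> consists of all sections, locality leaves only one section.\<close>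
  have "s = \<zero>\<^bsub>sec E U j\<^esub>" if s: "s \<in> ?I" for s
  proof (rule E.locality[of \<U> s j])
    show "s \<in> carrier (sec E (\<Union>\<U>) j)" "\<zero>\<^bsub>sec E U j\<^esub> \<in> carrier (sec E (\<Union>\<U>) j)"
      unfolding Un using s zero by (auto simp: invisible_part_def)
    show "\<forall>V\<in>\<U>. res E (\<Union>\<U>) V j s = res E (\<Union>\<U>) V j \<zero>\<^bsub>sec E U j\<^esub>"
      unfolding Un unfolding \<U>_def using s zero by blast
  qed (simp add: \<U>_def)
  with zero show "?I = {\<zero>\<^bsub>sec E U j\<^esub>}"
    by blast
qed

end
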